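(* Let $N\ge 2$ be an integer and let $\alpha_c(\beta)\in[0,\infty]$ be the critical value, for $0<\beta<\infty$, of long-range percolation on the hierarchical lattice $\Omega_N$ of order $N$. Then: (a) $\alpha_c(\beta)=0$ for $0<\beta\le N$; (b) $0<\alpha_c(\beta)<\infty$ for $N<\beta<N^2$; (c) $\alpha_c(\beta)=\infty$ for $\beta\ge N^2$.
   Context: For an integer $N\ge 2$, the hierarchical lattice of order $N$ is the countable set $\Omega_N=\{\mathbf x=(x_1,x_2,\ldots): x_i\in\{0,1,\ldots,N-1\},\ \sum_i x_i<\infty\}$ with the (ultra)metric $d(\mathbf x,\mathbf x)=0$ and $d(\mathbf x,\mathbf y)=\max\{i: x_i\ne y_i\}$ for $\mathbf x\ne \mathbf y$. Write $0$ for the all-zero sequence. Long-range percolation on $\Omega_N$ with parameters $0\le\alpha<\infty$ and $0<\beta<\infty$: each unordered pair of distinct vertices $x,y\in\Omega_N$ is, independently of all other pairs, joined by an (undirected) edge with probability $p_k=1-\exp(-\alpha/\beta^{k})$, where $k=d(x,y)$. The law is denoted $\mathbb P_{\alpha,\beta}$. The cluster $\mathcal C(x)$ is the connected component of $x$ in the resulting random graph (all vertices reachable from $x$ by finite paths of present edges). The percolation probability is $\theta(\alpha,\beta)=\mathbb P_{\alpha,\beta}(|\mathcal C(0)|=\infty)$, and the critical value is $\alpha_c(\beta)=\inf\{\alpha\ge 0:\theta(\alpha,\beta)>0\}$ (with $\inf\emptyset=\infty$). *)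

theory Defs
  imports "HOL-Probability.Probability"
begin

text \<open>Coordinates are numbered from 1 as in $(x_1, x_2, \ldots)$: the value of a sequence at
  index 0 is a dummy, fixed to be 0.\<close>

definition hier_lattice :: "nat \<Rightarrow> (nat \<Rightarrow> nat) set" where
  "hier_lattice N = {x. x 0 = 0 \<and> (\<forall>i\<ge>1. x i < N) \<and> summable (\<lambda>i. real (x i))}"

definition hier_dist :: "(nat \<Rightarrow> nat) \<Rightarrow> (nat \<Rightarrow> nat) \<Rightarrow> nat" where
  "hier_dist x y = (if x = y then 0 else Max {i. x i \<noteq> y i})"

definition vertex_pairs :: "nat \<Rightarrow> (nat \<Rightarrow> nat) set set" where
  "vertex_pairs N = {{x, y} | x y. x \<in> hier_lattice N \<and> y \<in> hier_lattice N \<and> x \<noteq> y}"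

text \<open>The distance between the two members of an unordered pair, see \<open>pair_dist_doubleton\<close>.\<close>

definition pair_dist :: "(nat \<Rightarrow> nat) set \<Rightarrow> nat" where
  "pair_dist e = Max {hier_dist x y | x y. x \<in> e \<and> y \<in> e}"

lemma hier_dist_commute: "hier_dist x y = hier_dist y x"
  by (simp add: hier_dist_def eq_commute)

lemma pair_dist_doubleton: "pair_dist {x, y} = hier_dist x y"
proof -
  have "{hier_dist u v | u v. u \<in> {x, y} \<and> v \<in> {x, y}} = {0, hier_dist x y}"
    using hier_dist_commute[of x y] by (auto simp: hier_dist_def)
  then show ?thesis
    by (simp add: pair_dist_def)
qed

definition edge_prob :: "real \<Rightarrow> real \<Rightarrow> nat \<Rightarrow> real" where
  "edge_prob \<alpha> \<beta> k = 1 - exp (- (\<alpha> / \<beta> ^ k))"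

text \<open>A configuration assigns to every unordered pair whether the corresponding edge is present.\<close>

definition percolation :: "nat \<Rightarrow> real \<Rightarrow> real \<Rightarrow> ((nat \<Rightarrow> nat) set \<Rightarrow> bool) measure" where
  "percolation N \<alpha> \<beta> =
    (\<Pi>\<^sub>M e\<in>vertex_pairs N. measure_pmf (bernoulli_pmf (edge_prob \<alpha> \<beta> (pair_dist e))))"

definition cluster :: "nat \<Rightarrow> ((nat \<Rightarrow> nat) set \<Rightarrow> bool) \<Rightarrow> (nat \<Rightarrow> nat) \<Rightarrow> (nat \<Rightarrow> nat) set" where
  "cluster N \<omega> x = {y. (x, y) \<in> {(u, v). {u, v} \<in> vertex_pairs N \<and> \<omega> {u, v}}\<^sup>*}"

definition perc_prob :: "nat \<Rightarrow> real \<Rightarrow> real \<Rightarrow> real" where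
  "perc_prob N \<alpha> \<beta> = measure (percolation N \<alpha> \<beta>)
     {\<omega> \<in> space (percolation N \<alpha> \<beta>). infinite (cluster N \<omega> (\<lambda>_. 0))}"

definition critical_value :: "nat \<Rightarrow> real \<Rightarrow> ereal" where
  "critical_value N \<beta> = Inf (ereal ` {\<alpha>. 0 \<le> \<alpha> \<and> perc_prob N \<alpha> \<beta> > 0})"

end

theory Submission
  imports Defs "HOL-Real_Asymp.Real_Asymp"
begin

text \<open>For $\beta \le N$ the expected degree of the origin is infinite, and the origin almost surely has
  edges of arbitrarily large length. For $\beta > N$ the expected degree is finite and proportional to
  $\alpha$; once it is below 1 the expected cluster size is bounded by a geometric series. For
  $\beta \ge N^2$ a ball is joined to its complement with probability bounded away from 1, whatever its
  radius, and these events are almost independent along well separated scales. For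
  $N < \beta < N^2$ and large $\alpha$ one renormalises: two clusters of size about $N^n$ in neighbouring
  balls of radius $n$ are joined with probability about $1 - \exp (- \alpha (N^2 / \beta)^n)$.\<close>

section \<open>Finite-range events under a product of Bernoulli measures\<close>

text \<open>Probabilities are estimated for events decided by finitely many edges; the infinite
  cluster is reached from them by countable unions and intersections, since the cluster of the
  origin is the increasing union of its clusters inside balls. For \<beta> \<ge> N^2 the obstacle is
  that one long edge leaves many balls at once, which makes the escapes from different balls
  dependent; edges that jump over the next scale are therefore split off and handled by a union
  bound. In the renormalisation the failure probability must shrink from level to level, so a block
  tolerates one bad subblock and fails only if two independent ones are bad. The price is that
  cluster sizes grow by N - 1 instead of N per level, which beats \<beta> only if (N - 1)^2 >
  \<beta>. Treating K levels as one replaces N by M = N^K, and (M - 1)^2 > \<beta>^K holds for large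
  K whenever \<beta> < N^2. Edges between two random clusters remain independent of them because
  each cluster is selected by looking only inside its own block. The block of the origin may not be
  the tolerated failure: its failure probabilities add up, with summable increments.\<close>

definition depends_on :: "'e set \<Rightarrow> (('e \<Rightarrow> bool) \<Rightarrow> 'b) \<Rightarrow> bool" where
  "depends_on J P \<longleftrightarrow> (\<forall>\<omega> \<omega>'. (\<forall>e\<in>J. \<omega> e = \<omega>' e) \<longrightarrow> P \<omega> = P \<omega>')"

lemma depends_onI: "(\<And>\<omega> \<omega>'. \<forall>e\<in>J. \<omega> e = \<omega>' e \<Longrightarrow> P \<omega> = P \<omega>') \<Longrightarrow> depends_on J P"
  unfolding depends_on_def by blast

lemma depends_onD: "depends_on J P \<Longrightarrow> \<forall>e\<in>J. \<omega> e = \<omega>' e \<Longrightarrow> P \<omega> = P \<omega>'"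
  unfolding depends_on_def by blast

lemma depends_on_mono: "depends_on J P \<Longrightarrow> J \<subseteq> K \<Longrightarrow> depends_on K P"
  unfolding depends_on_def by blast

text \<open>The bridge from predicates on all configurations to events of the product over
  \<open>J\<close> alone; for finite \<open>J\<close> it yields both measurability and
  independence.\<close>

lemma depends_on_restrict: "depends_on J P \<Longrightarrow> P (restrict \<omega> J) = P \<omega>"
  by (rule depends_onD) auto

lemma depends_on_comp: "depends_on J f \<Longrightarrow> depends_on J (\<lambda>\<omega>. g (f \<omega>))"
  unfolding depends_on_def by metis

lemma depends_on_comp2:
  "depends_on J f \<Longrightarrow> depends_on K g \<Longrightarrow> depends_on (J \<union> K) (\<lambda>\<omega>. h (f \<omega>) (g \<omega>))"
  unfolding depends_on_def by (metis UnCI)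

lemma depends_on_ball: "(\<And>x. x \<in> X \<Longrightarrow> depends_on J (P x)) \<Longrightarrow> depends_on J (\<lambda>\<omega>. \<forall>x\<in>X. P x \<omega>)"
  unfolding depends_on_def by blast

lemma depends_on_edge: "depends_on {e} (\<lambda>\<omega>. \<omega> e)"
  by (rule depends_onI) simp

lemma depends_on_open: "depends_on J (\<lambda>\<omega>. \<exists>e\<in>J. \<omega> e)"
  unfolding depends_on_def by blast

locale bernoulli_product =
  fixes I :: "'e set" and p :: "'e \<Rightarrow> real"
  assumes p_nonneg: "e \<in> I \<Longrightarrow> 0 \<le> p e" and p_le_1: "e \<in> I \<Longrightarrow> p e \<le> 1"

sublocale bernoulli_product \<subseteq> product_prob_space "\<lambda>e. measure_pmf (bernoulli_pmf (p e))" I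
  by unfold_locales

context bernoulli_product
begin

abbreviation "\<PP> \<equiv> \<Pi>\<^sub>M e\<in>I. measure_pmf (bernoulli_pmf (p e))"

abbreviation Pr :: "(('e \<Rightarrow> bool) \<Rightarrow> bool) \<Rightarrow> real" where
  "Pr Q \<equiv> prob {\<omega> \<in> space \<PP>. Q \<omega>}"

text \<open>The joint law of the coordinate maps is the product measure itself, and the law of each
  coordinate is its factor. The empty index set is separate because the characterisation by laws
  asks for a nonempty one.\<close>

lemma indep_edges: "indep_vars (\<lambda>e. measure_pmf (bernoulli_pmf (p e))) (\<lambda>e \<omega>. \<omega> e) I"
proof (cases "I = {}")
  case True
  then show ?thesis
    unfolding indep_vars_def indep_sets_def by auto
next
  case False
  have "distr \<PP> \<PP> (\<lambda>x. \<lambda>i\<in>I. x i) = distr \<PP> \<PP> (\<lambda>x. x)"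
    by (rule distr_cong) (auto simp: space_PiM restrict_PiE)
  also have "\<dots> = (\<Pi>\<^sub>M i\<in>I. distr \<PP> (measure_pmf (bernoulli_pmf (p i))) (\<lambda>\<omega>. \<omega> i))"
    by (simp add: distr_id cong: PiM_cong) (rule PiM_cong, simp_all add: PiM_component)
  finally show ?thesis
    by (subst indep_vars_iff_distr_eq_PiM') (use False in auto)
qed

text \<open>Finitely many Boolean coordinates give a finite space whose singletons are
  boxes.\<close>

lemma sets_finite_PiM:
  assumes "finite J"
  shows "{\<omega> \<in> space (\<Pi>\<^sub>M e\<in>J. measure_pmf (bernoulli_pmf (p e))). Q \<omega>}
    \<in> sets (\<Pi>\<^sub>M e\<in>J. measure_pmf (bernoulli_pmf (p e)))" (is "?A \<in> sets ?M")
proof -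
  have fin: "finite ?A"
    by (rule finite_subset[of _ "J \<rightarrow>\<^sub>E (UNIV :: bool set)"])
       (use assms in \<open>auto simp: space_PiM intro!: finite_PiE\<close>)
  have "{f} \<in> sets ?M" if "f \<in> ?A" for f
  proof -
    have "{f} = Pi\<^sub>E J (\<lambda>e. {f e})"
      using that by (subst PiE_singleton) (auto simp: space_PiM PiE_def)
    also have "\<dots> \<in> sets ?M"
      using assms by (intro sets_PiM_I_finite) auto
    finally show ?thesis .
  qed
  with fin have "(\<Union>f\<in>?A. {f}) \<in> sets ?M"
    by (intro sets.finite_UN) auto
  then show ?thesis by simp
qed

text \<open>Restrictions of a configuration to disjoint edge sets are independent random elements,
  and over finite sets \<open>P\<close> and \<open>Q\<close> are events of these
  restrictions.\<close>

lemma indep_Pr: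
  assumes "finite J" "J \<subseteq> I" "depends_on J P" and "finite K" "K \<subseteq> I" "depends_on K Q"
    and "J \<inter> K = {}"
  shows "Pr (\<lambda>\<omega>. P \<omega> \<and> Q \<omega>) = Pr P * Pr Q"
proof -
  let ?M = "\<lambda>e. measure_pmf (bernoulli_pmf (p e))"
  have ind: "indep_var (PiM J ?M) (\<lambda>\<omega>. restrict (\<lambda>i. \<omega> i) J) (PiM K ?M) (\<lambda>\<omega>. restrict (\<lambda>i. \<omega> i) K)"
    using assms by (intro indep_var_restrict[OF indep_edges]) auto
  note PQ = depends_on_restrict[OF assms(3)] depends_on_restrict[OF assms(6)]
  show ?thesis
    using indep_varD[OF ind sets_finite_PiM[OF \<open>finite J\<close>, of P] sets_finite_PiM[OF \<open>finite K\<close>, of Q]]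
    by (simp add: vimage_def space_PiM PQ Int_def conj_ac cong: conj_cong)
qed

lemma depends_on_measurable:
  assumes "finite J" "J \<subseteq> I" "depends_on J P"
  shows "{\<omega> \<in> space \<PP>. P \<omega>} \<in> events"
proof -
  let ?M = "\<lambda>e. measure_pmf (bernoulli_pmf (p e))"
  have "(\<lambda>\<omega>. restrict \<omega> J) -` {\<omega> \<in> space (PiM J ?M). P \<omega>} \<inter> space \<PP> \<in> events"
    using assms by (intro measurable_sets[OF measurable_restrict_subset] sets_finite_PiM) auto
  then show ?thesis
    by (simp add: depends_on_restrict[OF assms(3)] vimage_def space_PiM Int_def conj_ac cong: conj_cong)
qed

lemma Pr_all_closed:
  assumes "finite J" "J \<subseteq> I"
  shows "Pr (\<lambda>\<omega>. \<forall>e\<in>J. \<not> \<omega> e) = (\<Prod>e\<in>J. 1 - p e)"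
proof -
  let ?M = "\<lambda>e. measure_pmf (bernoulli_pmf (p e))"
  have "emeasure \<PP> {\<omega> \<in> space \<PP>. \<forall>e\<in>J. \<omega> e \<in> {False}} = (\<Prod>e\<in>J. emeasure (?M e) {False})"
    using assms by (intro emeasure_PiM_Collect) auto
  then have "Pr (\<lambda>\<omega>. \<forall>e\<in>J. \<not> \<omega> e) = (\<Prod>e\<in>J. measure (?M e) {False})"
    by (simp add: emeasure_eq_measure measure_pmf.emeasure_eq_measure prod_ennreal prod_nonneg)
  also have "\<dots> = (\<Prod>e\<in>J. 1 - p e)"
    using assms p_nonneg p_le_1 by (intro prod.cong) (auto simp: measure_pmf_single)
  finally show ?thesis .
qed

lemma Pr_not:
  assumes "finite J" "J \<subseteq> I" "depends_on J P"
  shows "Pr (\<lambda>\<omega>. \<not> P \<omega>) = 1 - Pr P"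
  using prob_neg[OF depends_on_measurable[OF assms]] by simp

lemma Pr_edge:
  assumes "e \<in> I"
  shows "Pr (\<lambda>\<omega>. \<omega> e) = p e"
  using Pr_all_closed[of "{e}"] Pr_not[of "{e}" "\<lambda>\<omega>. \<omega> e"] depends_on_edge[of e] assms by auto

lemma Pr_mono:
  assumes "finite K" "K \<subseteq> I" "depends_on K Q" and "\<And>\<omega>. P \<omega> \<Longrightarrow> Q \<omega>"
  shows "Pr P \<le> Pr Q"
  using assms(4) by (intro finite_measure_mono depends_on_measurable[OF assms(1-3)]) auto

lemma Pr_disj:
  assumes "finite J" "J \<subseteq> I" "depends_on J P" "depends_on J Q"
  shows "Pr (\<lambda>\<omega>. P \<omega> \<or> Q \<omega>) \<le> Pr P + Pr Q"
proof -
  have "{\<omega> \<in> space \<PP>. P \<omega> \<or> Q \<omega>} = {\<omega> \<in> space \<PP>. P \<omega>} \<union> {\<omega> \<in> space \<PP>. Q \<omega>}"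
    by auto
  then show ?thesis
    using assms by (auto intro!: measure_Un_le depends_on_measurable)
qed

lemma Pr_bex:
  assumes "finite J" "J \<subseteq> I" "finite X" "\<And>x. x \<in> X \<Longrightarrow> depends_on J (P x)"
  shows "Pr (\<lambda>\<omega>. \<exists>x\<in>X. P x \<omega>) \<le> (\<Sum>x\<in>X. Pr (P x))"
proof -
  have "{\<omega> \<in> space \<PP>. \<exists>x\<in>X. P x \<omega>} = (\<Union>x\<in>X. {\<omega> \<in> space \<PP>. P x \<omega>})"
    by auto
  then show ?thesis
    using assms by (auto intro!: measure_UNION_le depends_on_measurable)
qed

lemma Pr_exists_open:
  assumes "finite J" "J \<subseteq> I"
  shows "Pr (\<lambda>\<omega>. \<exists>e\<in>J. \<omega> e) \<le> (\<Sum>e\<in>J. p e)"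
proof -
  have "Pr (\<lambda>\<omega>. \<exists>e\<in>J. \<omega> e) \<le> (\<Sum>e\<in>J. Pr (\<lambda>\<omega>. \<omega> e))"
    using assms by (intro Pr_bex[of J]) (auto intro: depends_on_mono[OF depends_on_edge])
  also have "\<dots> = (\<Sum>e\<in>J. p e)"
    using assms by (intro sum.cong) (auto simp: Pr_edge)
  finally show ?thesis .
qed

lemma sum_Pr_disjoint:
  assumes "finite J" "J \<subseteq> I" "finite X" "\<And>x. x \<in> X \<Longrightarrow> depends_on J (P x)"
    and "\<And>\<omega> x y. x \<in> X \<Longrightarrow> y \<in> X \<Longrightarrow> P x \<omega> \<Longrightarrow> P y \<omega> \<Longrightarrow> x = y"
  shows "(\<Sum>x\<in>X. Pr (P x)) \<le> 1"
proof -
  have "(\<Sum>x\<in>X. Pr (P x)) = prob (\<Union>x\<in>X. {\<omega> \<in> space \<PP>. P x \<omega>})"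
    using assms 
    by (intro finite_measure_finite_Union[symmetric])
       (auto simp: disjoint_family_on_def intro!: depends_on_measurable)
  then show ?thesis by simp
qed

text \<open>Continuity from below. The bound is asked only from \<open>l\<close> on, since in the
  applications it may hold only once the window contains all scales under consideration.\<close>

lemma Pr_ex_mono_le:
  fixes P :: "nat \<Rightarrow> ('e \<Rightarrow> bool) \<Rightarrow> bool"
  assumes "\<And>n. finite (J n)" "\<And>n. J n \<subseteq> I" "\<And>n. depends_on (J n) (P n)"
    and mono: "\<And>\<omega> m n. m \<le> n \<Longrightarrow> P m \<omega> \<Longrightarrow> P n \<omega>"
    and bound: "\<And>n. n \<ge> l \<Longrightarrow> Pr (P n) \<le> c"
  shows "Pr (\<lambda>\<omega>. \<exists>n. P n \<omega>) \<le> c"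
proof -
  let ?A = "\<lambda>n. {\<omega> \<in> space \<PP>. P n \<omega>}"
  have m: "?A n \<in> events" for n
    using assms by (intro depends_on_measurable) 
  have "(\<lambda>n. prob (?A n)) \<longlonglongrightarrow> prob (\<Union>n. ?A n)"
    using m mono by (intro finite_Lim_measure_incseq) (auto simp: incseq_def)
  then have "prob (\<Union>n. ?A n) \<le> c"
    by (rule LIMSEQ_le_const2) (use bound in blast)
  also have "(\<Union>n. ?A n) = {\<omega> \<in> space \<PP>. \<exists>n. P n \<omega>}"
    by auto
  finally show ?thesis .
qed

end

section \<open>Clusters in a finite random graph\<close>

definition pairs :: "'v set \<Rightarrow> 'v set set" where
  "pairs V = {{u, v} | u v. u \<in> V \<and> v \<in> V \<and> u \<noteq> v}"

definition cross :: "'v set \<Rightarrow> 'v set \<Rightarrow> 'v set set" where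
  "cross A B = (\<lambda>(u, v). {u, v}) ` (A \<times> B)"

text \<open>The relation behind \<open>cluster\<close>, with paths confined to \<open>V\<close>; for
  finite \<open>V\<close> it is decided by finitely many edges. A vertex outside \<open>V\<close> is
  alone in its cluster.\<close>

definition conn :: "'v set \<Rightarrow> ('v set \<Rightarrow> bool) \<Rightarrow> 'v \<Rightarrow> 'v set" where
  "conn V \<omega> x = {y. (x, y) \<in> {(u, v). {u, v} \<in> pairs V \<and> \<omega> {u, v}}\<^sup>*}"

lemma pairs_iff: "{u, v} \<in> pairs V \<longleftrightarrow> u \<in> V \<and> v \<in> V \<and> u \<noteq> v"
  by (auto simp: pairs_def doubleton_eq_iff)

lemma pairs_mono: "V \<subseteq> W \<Longrightarrow> pairs V \<subseteq> pairs W"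
  by (auto simp: pairs_def)

lemma finite_pairs: "finite V \<Longrightarrow> finite (pairs V)"
  by (rule finite_subset[of _ "Pow V"]) (auto simp: pairs_def)

lemma finite_cross: "finite A \<Longrightarrow> finite B \<Longrightarrow> finite (cross A B)"
  by (simp add: cross_def)

lemma cross_subset_pairs: "A \<inter> B = {} \<Longrightarrow> A \<subseteq> V \<Longrightarrow> B \<subseteq> V \<Longrightarrow> cross A B \<subseteq> pairs V"
  by (auto simp: cross_def pairs_iff)

lemma inj_on_cross: "A \<inter> B = {} \<Longrightarrow> inj_on (\<lambda>(u, v). {u, v}) (A \<times> B)"
  by (auto simp: inj_on_def doubleton_eq_iff)

lemma sum_cross: "A \<inter> B = {} \<Longrightarrow> sum f (cross A B) = (\<Sum>u\<in>A. \<Sum>v\<in>B. f {u, v})"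
  unfolding cross_def
  by (subst sum.reindex[OF inj_on_cross]) (auto simp: sum.cartesian_product intro!: sum.cong)

lemma card_cross: "A \<inter> B = {} \<Longrightarrow> card (cross A B) = card A * card B"
  unfolding cross_def by (simp add: card_image[OF inj_on_cross] card_cartesian_product)

lemma conn_refl: "x \<in> conn V \<omega> x"
  by (simp add: conn_def)

lemma conn_trans: "y \<in> conn V \<omega> x \<Longrightarrow> z \<in> conn V \<omega> y \<Longrightarrow> z \<in> conn V \<omega> x"
  by (simp add: conn_def)

lemma conn_sym: "y \<in> conn V \<omega> x \<Longrightarrow> x \<in> conn V \<omega> y"
proof -
  have "sym ({(u, v). {u, v} \<in> pairs V \<and> \<omega> {u, v}}\<^sup>*)"
    by (rule sym_rtrancl) (simp add: sym_def insert_commute)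
  then show "y \<in> conn V \<omega> x \<Longrightarrow> x \<in> conn V \<omega> y"
    by (auto simp: conn_def dest: symD)
qed

lemma conn_edge: "\<omega> {u, v} \<Longrightarrow> {u, v} \<in> pairs V \<Longrightarrow> v \<in> conn V \<omega> u"
  by (auto simp: conn_def)

lemma conn_subset_closed:
  assumes "x \<in> A" and "\<And>u v. u \<in> A \<Longrightarrow> v \<in> V - A \<Longrightarrow> u \<in> V \<Longrightarrow> \<not> \<omega> {u, v}"
  shows "conn V \<omega> x \<subseteq> A"
proof
  fix y assume "y \<in> conn V \<omega> x"
  then have "(x, y) \<in> {(u, v). {u, v} \<in> pairs V \<and> \<omega> {u, v}}\<^sup>*"
    by (simp add: conn_def)
  then show "y \<in> A"
    by induction (use assms in \<open>auto simp: pairs_iff\<close>)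
qed

lemma conn_subset: "x \<in> V \<Longrightarrow> conn V \<omega> x \<subseteq> V"
  by (rule conn_subset_closed) auto

lemma conn_mono:
  assumes "V \<subseteq> W"
  shows "conn V \<omega> x \<subseteq> conn W \<omega> x"
proof -
  have "{(u, v). {u, v} \<in> pairs V \<and> \<omega> {u, v}} \<subseteq> {(u, v). {u, v} \<in> pairs W \<and> \<omega> {u, v}}"
    using pairs_mono[OF assms] by auto
  from rtrancl_mono[OF this] show ?thesis
    by (auto simp: conn_def)
qed

lemma depends_on_conn: "depends_on (pairs V) (\<lambda>\<omega>. conn V \<omega> x)"
proof (rule depends_onI)
  fix \<omega> \<omega>' :: "'a set \<Rightarrow> bool" assume "\<forall>e\<in>pairs V. \<omega> e = \<omega>' e"
  then have "{(u, v). {u, v} \<in> pairs V \<and> \<omega> {u, v}} = {(u, v). {u, v} \<in> pairs V \<and> \<omega>' {u, v}}"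
    by auto
  then show "conn V \<omega> x = conn V \<omega>' x"
    by (simp add: conn_def)
qed

lemma finite_subset_incseq:
  assumes "finite F" "incseq A" "F \<subseteq> (\<Union>n. A n)"
  shows "\<exists>n :: nat. F \<subseteq> A n"
  using assms(1,3)
proof induction
  case (insert x F)
  then obtain m n where "F \<subseteq> A m" "x \<in> A n"
    by auto
  moreover have "A m \<subseteq> A (max m n)" "A n \<subseteq> A (max m n)"
    by (simp_all add: incseqD[OF assms(2)])
  ultimately show ?case
    by (intro exI[of _ "max m n"]) blast
qed simp

text \<open>A path has finitely many vertices, so it already runs inside one \<open>B n\<close>; the
  induction along the path enlarges \<open>n\<close> at each step.\<close>

lemma conn_UN_incseq:
  assumes "incseq B"
  shows "conn (\<Union>m. B m) \<omega> x = (\<Union>m. conn (B m) \<omega> x)"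
proof
  show "(\<Union>m. conn (B m) \<omega> x) \<subseteq> conn (\<Union>m. B m) \<omega> x"
    by (intro UN_least conn_mono) auto
  show "conn (\<Union>m. B m) \<omega> x \<subseteq> (\<Union>m. conn (B m) \<omega> x)"
  proof
    fix y assume "y \<in> conn (\<Union>m. B m) \<omega> x"
    then have "(x, y) \<in> {(u, v). {u, v} \<in> pairs (\<Union>m. B m) \<and> \<omega> {u, v}}\<^sup>*"
      by (simp add: conn_def)
    then show "y \<in> (\<Union>m. conn (B m) \<omega> x)"
    proof induction
      case base
      then show ?case by (auto intro: conn_refl)
    next
      case (step y z)
      then obtain k l m where *: "y \<in> conn (B k) \<omega> x" "y \<in> B l" "z \<in> B m" "y \<noteq> z" "\<omega> {y, z}"
        by (auto simp: pairs_iff)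
      define n where "n = max k (max l m)"
      have sub: "B k \<subseteq> B n" "B l \<subseteq> B n" "B m \<subseteq> B n"
        by (simp_all add: n_def incseqD[OF assms])
      have "y \<in> conn (B n) \<omega> x"
        using *(1) conn_mono[OF sub(1)] by blast
      moreover have "z \<in> conn (B n) \<omega> y"
        using * sub by (intro conn_edge) (auto simp: pairs_iff)
      ultimately show ?case
        using conn_trans by fast
    qed
  qed
qed

text \<open>A path from \<open>x\<close>, cut at its last visit to \<open>x\<close>, consists of one
  edge at \<open>x\<close> and a path avoiding \<open>x\<close>. Formally, the right-hand side
  contains \<open>x\<close> and no open edge of \<open>V\<close> leaves it.\<close>

lemma conn_remove:
  assumes "x \<in> V"
  shows "conn V \<omega> x \<subseteq> insert x (\<Union>z\<in>{z \<in> V - {x}. \<omega> {x, z}}. conn (V - {x}) \<omega> z)"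
proof (rule conn_subset_closed)
  let ?A = "insert x (\<Union>z\<in>{z \<in> V - {x}. \<omega> {x, z}}. conn (V - {x}) \<omega> z)"
  fix u v assume u: "u \<in> ?A" "u \<in> V" and v: "v \<in> V - ?A"
  show "\<not> \<omega> {u, v}"
  proof
    assume *: "\<omega> {u, v}"
    show False
    proof (cases "u = x")
      case True
      then show False using * v by (auto intro: conn_refl)
    next
      case False
      then obtain z where z: "z \<in> V - {x}" "\<omega> {x, z}" "u \<in> conn (V - {x}) \<omega> z"
        using u by auto
      moreover have "v \<in> conn (V - {x}) \<omega> u"
        using * u v False by (intro conn_edge) (auto simp: pairs_iff intro: conn_refl z)
      ultimately show False
        using v conn_trans by fastforce
    qed
  qed
qed auto

section \<open>Expected cluster size when the expected degree is below 1\<close>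

locale random_graph = bernoulli_product "pairs L" p for L :: "'v set" and p
begin

text \<open>Subcritical case: deleting \<open>x\<close> makes the first edge of a path from \<open>x\<close> independent of the
  rest, so that the expected cluster size satisfies a geometric-series recursion.\<close>

lemma expected_cluster_bound:
  assumes "finite V" "V \<subseteq> L" "x \<in> V" and "\<rho> < 1"
    and "\<And>u. u \<in> V \<Longrightarrow> (\<Sum>v\<in>V - {u}. p {u, v}) \<le> \<rho>"
  shows "(\<Sum>y\<in>V. Pr (\<lambda>\<omega>. y \<in> conn V \<omega> x)) \<le> 1 / (1 - \<rho>)"
  using assms
proof (induction V arbitrary: x rule: finite_psubset_induct)
  case (psubset V)
  let ?W = "V - {x}"
  have fW: "finite (pairs ?W)" "pairs ?W \<subseteq> pairs L" and fV: "finite (pairs V)" "pairs V \<subseteq> pairs L"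
    using psubset by (auto intro!: finite_pairs pairs_mono)
  have IH: "(\<Sum>y\<in>?W. Pr (\<lambda>\<omega>. y \<in> conn ?W \<omega> z)) \<le> 1 / (1 - \<rho>)" if "z \<in> ?W" for z
  proof (rule psubset.IH)
    fix u assume "u \<in> ?W"
    have "(\<Sum>v\<in>?W - {u}. p {u, v}) \<le> (\<Sum>v\<in>V - {u}. p {u, v})"
      using psubset \<open>u \<in> ?W\<close> by (intro sum_mono2) (auto intro!: p_nonneg simp: pairs_iff)
    also have "\<dots> \<le> \<rho>"
      using psubset \<open>u \<in> ?W\<close> by auto
    finally show "(\<Sum>v\<in>?W - {u}. p {u, v}) \<le> \<rho>" .
  qed (use psubset that in auto)
  have indep: "Pr (\<lambda>\<omega>. \<omega> {x, z} \<and> y \<in> conn ?W \<omega> z) = p {x, z} * Pr (\<lambda>\<omega>. y \<in> conn ?W \<omega> z)"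
    if "z \<in> ?W" for y z
  proof -
    have "Pr (\<lambda>\<omega>. \<omega> {x, z} \<and> y \<in> conn ?W \<omega> z) = Pr (\<lambda>\<omega>. \<omega> {x, z}) * Pr (\<lambda>\<omega>. y \<in> conn ?W \<omega> z)"
      using fW that psubset
      by (intro indep_Pr[of "{{x, z}}" _ "pairs ?W"] depends_on_edge depends_on_comp[OF depends_on_conn])
         (auto simp: pairs_iff)
    also have "Pr (\<lambda>\<omega>. \<omega> {x, z}) = p {x, z}"
      using that psubset by (intro Pr_edge) (auto simp: pairs_iff)
    finally show ?thesis .
  qed
  have le: "Pr (\<lambda>\<omega>. y \<in> conn V \<omega> x) \<le> (\<Sum>z\<in>?W. p {x, z} * Pr (\<lambda>\<omega>. y \<in> conn ?W \<omega> z))"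
    if "y \<in> ?W" for y
  proof -
    have dep: "depends_on (pairs V) (\<lambda>\<omega>. \<omega> {x, z} \<and> y \<in> conn ?W \<omega> z)" if "z \<in> ?W" for z
      using that psubset(4) pairs_mono[of ?W V]
      by (intro depends_on_mono[OF depends_on_comp2[OF depends_on_edge depends_on_comp[OF depends_on_conn]]])
         (auto simp: pairs_iff)
    have "Pr (\<lambda>\<omega>. y \<in> conn V \<omega> x) \<le> Pr (\<lambda>\<omega>. \<exists>z\<in>?W. \<omega> {x, z} \<and> y \<in> conn ?W \<omega> z)"
    proof (rule Pr_mono[OF fV])
      show "depends_on (pairs V) (\<lambda>\<omega>. \<exists>z\<in>?W. \<omega> {x, z} \<and> y \<in> conn ?W \<omega> z)"
        using dep unfolding depends_on_def by blast
      show "\<exists>z\<in>?W. \<omega> {x, z} \<and> y \<in> conn ?W \<omega> z" if "y \<in> conn V \<omega> x" for \<omega>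
        using conn_remove[of x V \<omega>] that \<open>y \<in> ?W\<close> psubset(4) by blast
    qed
    also have "\<dots> \<le> (\<Sum>z\<in>?W. Pr (\<lambda>\<omega>. \<omega> {x, z} \<and> y \<in> conn ?W \<omega> z))"
      using psubset dep by (intro Pr_bex[OF fV]) auto
    also have "\<dots> = (\<Sum>z\<in>?W. p {x, z} * Pr (\<lambda>\<omega>. y \<in> conn ?W \<omega> z))"
      by (intro sum.cong indep) auto
    finally show ?thesis .
  qed
  have "(\<Sum>y\<in>V. Pr (\<lambda>\<omega>. y \<in> conn V \<omega> x)) =
      Pr (\<lambda>\<omega>. x \<in> conn V \<omega> x) + (\<Sum>y\<in>?W. Pr (\<lambda>\<omega>. y \<in> conn V \<omega> x))"
    using psubset by (subst sum.remove[of _ x]) auto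
  also have "\<dots> \<le> 1 + (\<Sum>y\<in>?W. \<Sum>z\<in>?W. p {x, z} * Pr (\<lambda>\<omega>. y \<in> conn ?W \<omega> z))"
    by (intro add_mono prob_le_1 sum_mono le)
  also have "\<dots> = 1 + (\<Sum>z\<in>?W. p {x, z} * (\<Sum>y\<in>?W. Pr (\<lambda>\<omega>. y \<in> conn ?W \<omega> z)))"
    by (subst sum.swap) (simp add: sum_distrib_left)
  also have "\<dots> \<le> 1 + (\<Sum>z\<in>?W. p {x, z} * (1 / (1 - \<rho>)))"
    using psubset by (intro add_left_mono sum_mono mult_left_mono IH p_nonneg) (auto simp: pairs_iff)
  also have "\<dots> = 1 + (\<Sum>z\<in>?W. p {x, z}) * (1 / (1 - \<rho>))"
    by (simp only: sum_distrib_right)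
  \<comment> \<open>The value \<open>1 / (1 - \<rho>)\<close> is the fixed point of t = 1 + \<rho>
    t, so the recursion reproduces the claimed bound.\<close>
  also have "\<dots> \<le> 1 + \<rho> * (1 / (1 - \<rho>))"
    using psubset by (intro add_left_mono mult_right_mono) auto
  also have "\<dots> = 1 / (1 - \<rho>)"
    using \<open>\<rho> < 1\<close> by (simp add: field_simps)
  finally show ?case .
qed

text \<open>Markov's inequality, with the cluster size written as a sum of indicators over its
  possible members.\<close>

lemma large_cluster_markov:
  assumes "finite V" "V \<subseteq> L" "x \<in> V"
  shows "real k * Pr (\<lambda>\<omega>. k \<le> card (conn V \<omega> x)) \<le> (\<Sum>y\<in>V. Pr (\<lambda>\<omega>. y \<in> conn V \<omega> x))"
proof -
  have fV: "finite (pairs V)" "pairs V \<subseteq> pairs L"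
    using assms by (auto intro!: finite_pairs pairs_mono)
  let ?A = "{\<omega> \<in> space \<PP>. k \<le> card (conn V \<omega> x)}" and ?B = "\<lambda>y. {\<omega> \<in> space \<PP>. y \<in> conn V \<omega> x}"
  have A: "?A \<in> events" and B: "?B y \<in> events" for y
    by (intro depends_on_measurable[OF fV] depends_on_comp[OF depends_on_conn])+
  have "real k * prob ?A = expectation (\<lambda>\<omega>. real k * indicator ?A \<omega>)"
    using A by simp
  also have "\<dots> \<le> expectation (\<lambda>\<omega>. \<Sum>y\<in>V. indicator (?B y) \<omega>)"
  proof (rule integral_mono)
    fix \<omega> assume "\<omega> \<in> space \<PP>"
    then have "(\<Sum>y\<in>V. indicator (?B y) \<omega>) = real (card {y\<in>V. y \<in> conn V \<omega> x})"
      using assms by (simp add: indicator_def sum.If_cases Int_def)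
    also have "{y\<in>V. y \<in> conn V \<omega> x} = conn V \<omega> x"
      using conn_subset[OF \<open>x \<in> V\<close>] by auto
    finally show "real k * indicator ?A \<omega> \<le> (\<Sum>y\<in>V. indicator (?B y) \<omega>)"
      by (auto simp: indicator_def)
  qed (use A B in \<open>auto intro!: integrable_real_indicator simp: emeasure_eq_measure\<close>)
  also have "\<dots> = (\<Sum>y\<in>V. prob (?B y))"
    using B by (subst Bochner_Integration.integral_sum)
      (auto intro!: integrable_real_indicator simp: emeasure_eq_measure)
  finally show ?thesis .
qed

end

section \<open>Merging clusters of subblocks\<close>

text \<open>Every selected cluster has a direct open edge to the one containing \<open>u\<close>, so
  all of them join the cluster of \<open>u\<close>. Their sizes add up because the blocks are
  disjoint, and \<open>nonempty\<close> leaves at most one block without a contribution, whence the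
  factor \<open>card \<D> - 1\<close>.\<close>

lemma merged_cluster_card:
  assumes fin: "finite \<D>" "\<And>D. D \<in> \<D> \<Longrightarrow> finite D" and disj: "disjoint \<D>"
    and sub: "\<And>D. D \<in> \<D> \<Longrightarrow> \<sigma> D \<subseteq> D"
    and large: "\<And>D. D \<in> \<D> \<Longrightarrow> \<sigma> D \<noteq> {} \<Longrightarrow> s \<le> card (\<sigma> D)"
    and conn: "\<And>D u v. D \<in> \<D> \<Longrightarrow> u \<in> \<sigma> D \<Longrightarrow> v \<in> \<sigma> D \<Longrightarrow> v \<in> conn D \<omega> u"
    and nonempty: "\<And>D E. D \<in> \<D> \<Longrightarrow> E \<in> \<D> \<Longrightarrow> D \<noteq> E \<Longrightarrow> \<sigma> D \<noteq> {} \<or> \<sigma> E \<noteq> {}"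
    and linked: "\<And>D E. D \<in> \<D> \<Longrightarrow> E \<in> \<D> \<Longrightarrow> D \<noteq> E \<Longrightarrow> \<sigma> D \<noteq> {} \<Longrightarrow> \<sigma> E \<noteq> {} \<Longrightarrow>
      \<exists>e\<in>cross (\<sigma> D) (\<sigma> E). \<omega> e"
    and u: "D0 \<in> \<D>" "u \<in> \<sigma> D0"
  shows "(card \<D> - 1) * s \<le> card (conn (\<Union>\<D>) \<omega> u)"
proof -
  have up: "v \<in> conn (\<Union>\<D>) \<omega> w" if "D \<in> \<D>" "w \<in> \<sigma> D" "v \<in> \<sigma> D" for D v w
    using conn[OF that] conn_mono[of D "\<Union>\<D>" \<omega> w] that by auto
  have "\<sigma> D \<subseteq> conn (\<Union>\<D>) \<omega> u" if D: "D \<in> \<D>" for D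
  proof
    fix v assume v: "v \<in> \<sigma> D"
    show "v \<in> conn (\<Union>\<D>) \<omega> u"
    proof (cases "D = D0")
      case True
      then show ?thesis using up u v by auto
    next
      case False
      with linked[of D0 D] u v D obtain a b where ab: "a \<in> \<sigma> D0" "b \<in> \<sigma> D" "\<omega> {a, b}"
        by (auto simp: cross_def)
      moreover have "D \<inter> D0 = {}"
        using disj False D u(1) by (auto simp: disjoint_def)
      then have "a \<in> D0" "b \<in> D" "a \<noteq> b"
        using ab sub[OF D] sub[OF u(1)] by blast+
      ultimately have "b \<in> conn (\<Union>\<D>) \<omega> a"
        using D u(1) by (intro conn_edge) (auto simp: pairs_iff)
      then show ?thesis
        using up[OF u(1,2) ab(1)] up[OF D ab(2) v] by (blast intro: conn_trans)
    qed
  qed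
  then have *: "(\<Union>D\<in>\<D>. \<sigma> D) \<subseteq> conn (\<Union>\<D>) \<omega> u"
    by auto
  let ?N = "{D \<in> \<D>. \<sigma> D \<noteq> {}}"
  have "card (\<D> - ?N) \<le> 1"
    using nonempty fin by (subst card_le_Suc0_iff_eq[unfolded One_nat_def[symmetric]]) auto
  then have "card \<D> - 1 \<le> card ?N"
    using fin card_Diff_subset[of ?N \<D>] by auto
  then have "(card \<D> - 1) * s \<le> (\<Sum>D\<in>?N. s)"
    by simp
  also have "\<dots> \<le> (\<Sum>D\<in>?N. card (\<sigma> D))"
    using large by (intro sum_mono) auto
  also have "\<dots> \<le> (\<Sum>D\<in>\<D>. card (\<sigma> D))"
    using fin by (intro sum_mono2) auto
  also have "\<dots> = card (\<Union>D\<in>\<D>. \<sigma> D)"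
  proof (intro card_UN_disjoint[symmetric] ballI impI)
    fix D E assume DE: "D \<in> \<D>" "E \<in> \<D>" "D \<noteq> E"
    then have "D \<inter> E = {}" using disj by (auto simp: disjoint_def)
    then show "\<sigma> D \<inter> \<sigma> E = {}" using sub DE by blast
  qed (use fin sub in \<open>auto intro: finite_subset\<close>)
  also have "\<dots> \<le> card (conn (\<Union>\<D>) \<omega> u)"
    using * fin u sub[OF u(1)] by (intro card_mono finite_subset[OF conn_subset]) auto
  finally show ?thesis .
qed

text \<open>\<open>{}\<close> encodes that no cluster is selected.\<close>

definition selects :: "nat \<Rightarrow> 'v set \<Rightarrow> (('v set \<Rightarrow> bool) \<Rightarrow> 'v set) \<Rightarrow> bool" where
  "selects s D \<sigma> \<longleftrightarrow> depends_on (pairs D) \<sigma> \<and>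
    (\<forall>\<omega>. \<sigma> \<omega> \<noteq> {} \<longrightarrow> s \<le> card (\<sigma> \<omega>) \<and> (\<exists>u\<in>D. \<sigma> \<omega> = conn D \<omega> u))"

lemma selects_subset: "selects s D \<sigma> \<Longrightarrow> \<sigma> \<omega> \<subseteq> D"
  unfolding selects_def by (metis conn_subset empty_subsetI)

lemma selects_conn: "selects s D \<sigma> \<Longrightarrow> u \<in> \<sigma> \<omega> \<Longrightarrow> v \<in> \<sigma> \<omega> \<Longrightarrow> v \<in> conn D \<omega> u"
  unfolding selects_def by (metis conn_sym conn_trans empty_iff)

text \<open>The selector for the block of a prescribed vertex, whose own cluster must be followed
  from level to level.\<close>

lemma selects_own: 
  assumes "x \<in> D"
  shows "selects s D (\<lambda>\<omega>. if s \<le> card (conn D \<omega> x) then conn D \<omega> x else {})"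
  unfolding selects_def
  using assms depends_on_comp[OF depends_on_conn[of D x], of "\<lambda>C. if s \<le> card C then C else {}"] by auto

text \<open>The choice is made as a function of the map \<open>conn D \<omega>\<close> alone. An
  arbitrary \<open>SOME\<close> is then still decided by the edges inside \<open>D\<close>, which
  keeps it independent of edges leaving \<open>D\<close>.\<close>

lemma ex_selects_large:
  "\<exists>\<sigma>. selects s D \<sigma> \<and> (\<forall>\<omega>. \<sigma> \<omega> = {} \<longrightarrow> \<not> (\<exists>u\<in>D. s \<le> card (conn D \<omega> u)))"
proof -
  let ?g = "\<lambda>C. if \<exists>u\<in>D. s \<le> card (C u) then C (SOME u. u \<in> D \<and> s \<le> card (C u)) else {}"
  define \<sigma> where "\<sigma> = (\<lambda>\<omega>. ?g (conn D \<omega>))"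
  have "depends_on (pairs D) (conn D)"
    using depends_on_conn[of D] unfolding depends_on_def by blast
  then have dep: "depends_on (pairs D) \<sigma>"
    unfolding \<sigma>_def by (rule depends_on_comp)
  have large: "\<exists>u\<in>D. s \<le> card (conn D \<omega> u) \<and> \<sigma> \<omega> = conn D \<omega> u"
    if "\<exists>u\<in>D. s \<le> card (conn D \<omega> u)" for \<omega>
  proof -
    have "\<exists>u. u \<in> D \<and> s \<le> card (conn D \<omega> u)" using that by auto
    from someI_ex[OF this] that show ?thesis by (auto simp: \<sigma>_def)
  qed
  moreover have "\<sigma> \<omega> = {}" if "\<not> (\<exists>u\<in>D. s \<le> card (conn D \<omega> u))" for \<omega>
    using that by (simp add: \<sigma>_def)
  ultimately have "selects s D \<sigma>"
    using dep unfolding selects_def by metis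
  moreover have "\<forall>\<omega>. \<sigma> \<omega> = {} \<longrightarrow> \<not> (\<exists>u\<in>D. s \<le> card (conn D \<omega> u))"
    using large conn_refl by (metis empty_iff)
  ultimately show ?thesis by blast
qed

text \<open>\<open>S\<close> holds the blocks of which one may fail. It is all of
  \<open>\<D>\<close> when any large cluster will do, and omits the block of a distinguished vertex,
  whose success is then demanded separately.\<close>

definition merges :: "'a set set \<Rightarrow> 'a set set \<Rightarrow> ('a set \<Rightarrow> ('a set \<Rightarrow> bool) \<Rightarrow> 'a set) \<Rightarrow> ('a set \<Rightarrow> bool) \<Rightarrow> bool"
  where "merges \<D> S \<sigma> \<omega> \<longleftrightarrow>
    (\<forall>D\<in>\<D>. \<forall>E\<in>\<D>. D \<noteq> E \<longrightarrow> (D \<in> S \<longrightarrow> E \<in> S \<longrightarrow> \<sigma> D \<omega> \<noteq> {} \<or> \<sigma> E \<omega> \<noteq> {}) \<and>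
      (\<sigma> D \<omega> \<noteq> {} \<longrightarrow> \<sigma> E \<omega> \<noteq> {} \<longrightarrow> (\<exists>e\<in>cross (\<sigma> D \<omega>) (\<sigma> E \<omega>). \<omega> e)))"

lemma depends_on_selects:
  "selects s D \<sigma> \<Longrightarrow> D \<subseteq> V \<Longrightarrow> depends_on (pairs V) \<sigma>"
  by (auto simp: selects_def intro: depends_on_mono[OF _ pairs_mono])

lemma depends_on_unlinked:
  assumes "selects s D \<sigma>" "selects s E \<tau>" "D \<subseteq> V" "E \<subseteq> V" "D \<inter> E = {}"
  shows "depends_on (pairs V) (\<lambda>\<omega>. \<exists>e\<in>cross (\<sigma> \<omega>) (\<tau> \<omega>). \<omega> e)"
proof (rule depends_onI)
  fix \<omega> \<omega>' :: "'a set \<Rightarrow> bool" assume eq: "\<forall>e\<in>pairs V. \<omega> e = \<omega>' e"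
  have "depends_on (pairs V) \<sigma>" "depends_on (pairs V) \<tau>"
    using assms by (auto intro: depends_on_selects)
  from this[THEN depends_onD, OF eq] have "\<sigma> \<omega> = \<sigma> \<omega>'" "\<tau> \<omega> = \<tau> \<omega>'" .
  moreover have "cross (\<sigma> \<omega>') (\<tau> \<omega>') \<subseteq> pairs V"
    using assms selects_subset[OF assms(1)] selects_subset[OF assms(2)]
    by (intro cross_subset_pairs) blast+
  ultimately show "(\<exists>e\<in>cross (\<sigma> \<omega>) (\<tau> \<omega>). \<omega> e) = (\<exists>e\<in>cross (\<sigma> \<omega>') (\<tau> \<omega>'). \<omega>' e)"
    using eq by auto
qed

text \<open>The edges inspected between two blocks vary with the configuration, but the clusters
  that determine them do not change if the configuration is altered outside
  \<open>pairs (\<Union>\<D>)\<close>.\<close>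

lemma depends_on_merges:
  assumes "disjoint \<D>" "\<And>D. D \<in> \<D> \<Longrightarrow> selects s D (\<sigma> D)"
  shows "depends_on (pairs (\<Union>\<D>)) (merges \<D> S \<sigma>)"
proof -
  have d1: "depends_on (pairs (\<Union>\<D>)) (\<sigma> D)" if "D \<in> \<D>" for D
    using assms that by (intro depends_on_selects) auto
  have d2: "depends_on (pairs (\<Union>\<D>)) (\<lambda>\<omega>. \<exists>e\<in>cross (\<sigma> D \<omega>) (\<sigma> E \<omega>). \<omega> e)"
    if "D \<in> \<D>" "E \<in> \<D>" "D \<noteq> E" for D E
    using assms that by (intro depends_on_unlinked) (auto simp: disjoint_def)
  show ?thesis
  proof (rule depends_onI)
    fix \<omega> \<omega>' :: "'a set \<Rightarrow> bool"
    assume eq: "\<forall>e\<in>pairs (\<Union>\<D>). \<omega> e = \<omega>' e"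
    have a: "\<sigma> D \<omega> = \<sigma> D \<omega>'" if "D \<in> \<D>" for D
      using depends_onD[OF d1 eq] that .
    have b: "(\<exists>e\<in>cross (\<sigma> D \<omega>') (\<sigma> E \<omega>'). \<omega> e) = (\<exists>e\<in>cross (\<sigma> D \<omega>') (\<sigma> E \<omega>'). \<omega>' e)"
      if "D \<in> \<D>" "E \<in> \<D>" "D \<noteq> E" for D E
      using depends_onD[OF d2[OF that] eq] that by (simp add: a)
    show "merges \<D> S \<sigma> \<omega> = merges \<D> S \<sigma> \<omega>'"
      unfolding merges_def by (simp add: a b cong: ball_cong)
  qed
qed

lemma merged_cluster:
  assumes "finite \<D>" "\<And>D. D \<in> \<D> \<Longrightarrow> finite D" "disjoint \<D>"
    and "\<And>D. D \<in> \<D> \<Longrightarrow> selects s D (\<sigma> D)"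
    and "merges \<D> S \<sigma> \<omega>" and "\<And>D. D \<in> \<D> \<Longrightarrow> D \<notin> S \<Longrightarrow> \<sigma> D \<omega> \<noteq> {}"
    and "D0 \<in> \<D>" "u \<in> \<sigma> D0 \<omega>"
  shows "(card \<D> - 1) * s \<le> card (conn (\<Union>\<D>) \<omega> u)"
proof (rule merged_cluster_card[where \<sigma> = "\<lambda>D. \<sigma> D \<omega>"])
  show "\<sigma> D \<omega> \<subseteq> D" if "D \<in> \<D>" for D
    using selects_subset[OF assms(4)[OF that]] .
  show "v \<in> conn D \<omega> u" if "D \<in> \<D>" "u \<in> \<sigma> D \<omega>" "v \<in> \<sigma> D \<omega>" for D u v
    using selects_conn[OF assms(4)[OF that(1)] that(2,3)] .
  show "s \<le> card (\<sigma> D \<omega>)" if "D \<in> \<D>" "\<sigma> D \<omega> \<noteq> {}" for D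
    using assms(4) that unfolding selects_def by blast
  show "\<sigma> D \<omega> \<noteq> {} \<or> \<sigma> E \<omega> \<noteq> {}" if "D \<in> \<D>" "E \<in> \<D>" "D \<noteq> E" for D E
    using assms(5,6) that unfolding merges_def by blast
qed (use assms in \<open>auto simp: merges_def\<close>)

section \<open>Failure probabilities of a merge\<close>

context random_graph
begin

text \<open>Decompose by the pair (A, B) of selected clusters. Given it, the at least s^2 edges
  between A and B are still independent and each is closed with probability at most
  \<open>q\<close>; the events of selecting different pairs are disjoint, so their probabilities sum
  to at most 1.\<close>

lemma unlinked_bound:
  assumes fin: "finite D" "finite E" and L: "D \<subseteq> L" "E \<subseteq> L" and disj: "D \<inter> E = {}"
    and \<sigma>: "selects s D \<sigma>" and \<tau>: "selects s E \<tau>"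
    and q: "0 \<le> q" "q \<le> 1" "\<And>u v. u \<in> D \<Longrightarrow> v \<in> E \<Longrightarrow> 1 - p {u, v} \<le> q"
  shows "Pr (\<lambda>\<omega>. \<sigma> \<omega> \<noteq> {} \<and> \<tau> \<omega> \<noteq> {} \<and> \<not> (\<exists>e\<in>cross (\<sigma> \<omega>) (\<tau> \<omega>). \<omega> e)) \<le> q ^ s\<^sup>2"
proof -
  let ?J = "pairs D \<union> pairs E"
  define X where "X = {(A, B). A \<subseteq> D \<and> B \<subseteq> E \<and> s \<le> card A \<and> s \<le> card B}"
  have finX: "finite X"
    using fin by (intro finite_subset[of X "Pow D \<times> Pow E"]) (auto simp: X_def)
  have J: "finite ?J" "?J \<subseteq> pairs L"
    using fin pairs_mono[OF L(1)] pairs_mono[OF L(2)] by (auto intro!: finite_pairs)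
  define R where "R = (\<lambda>x \<omega>. (\<sigma> \<omega>, \<tau> \<omega>) = x)"
  have dR: "depends_on ?J (R x)" for x
    unfolding R_def using \<sigma> \<tau> by (intro depends_on_comp2) (auto simp: selects_def)
  have closed: "Pr (\<lambda>\<omega>. \<forall>e\<in>cross A B. \<not> \<omega> e) \<le> q ^ s\<^sup>2" if "(A, B) \<in> X" for A B
  proof -
    have AB: "A \<subseteq> D" "B \<subseteq> E" "s \<le> card A" "s \<le> card B" "A \<inter> B = {}" "finite A" "finite B"
      using that fin disj by (auto simp: X_def intro: finite_subset)
    have "Pr (\<lambda>\<omega>. \<forall>e\<in>cross A B. \<not> \<omega> e) = (\<Prod>e\<in>cross A B. 1 - p e)"
      using AB L by (intro Pr_all_closed finite_cross cross_subset_pairs) auto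
    also have "\<dots> \<le> (\<Prod>e\<in>cross A B. q)"
    proof (rule prod_mono)
      fix e assume e: "e \<in> cross A B"
      have "e \<in> pairs L"
        using e cross_subset_pairs[OF AB(5), of L] AB(1,2) L by blast
      then show "0 \<le> 1 - p e \<and> 1 - p e \<le> q"
        using e p_le_1[of e] AB(1,2) q(3) by (auto simp: cross_def subset_iff)
    qed
    also have "\<dots> = q ^ (card A * card B)"
      using AB by (simp add: card_cross)
    also have "\<dots> \<le> q ^ s\<^sup>2"
      using AB q by (intro power_decreasing) (auto simp: power2_eq_square intro: mult_mono)
    finally show ?thesis .
  qed
  have dC: "depends_on (cross A B) (\<lambda>\<omega>. \<forall>e\<in>cross A B. \<not> \<omega> e)" for A B :: "'v set"
    unfolding depends_on_def by auto
  have bound: "Pr (\<lambda>\<omega>. R x \<omega> \<and> (\<forall>e\<in>cross (fst x) (snd x). \<not> \<omega> e)) \<le> Pr (R x) * q ^ s\<^sup>2" if x: "x \<in> X" for x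
  proof -
    obtain A B where AB: "x = (A, B)" by force
    have sub: "A \<subseteq> D" "B \<subseteq> E" using x by (auto simp: AB X_def)
    \<comment> \<open>The selections look inside \<open>D\<close> and inside \<open>E\<close>, never
      at an edge between them.\<close>
    have "?J \<inter> cross A B = {}"
      using sub disj by (auto simp: cross_def pairs_iff)
    then have "Pr (\<lambda>\<omega>. R x \<omega> \<and> (\<forall>e\<in>cross A B. \<not> \<omega> e)) = Pr (R x) * Pr (\<lambda>\<omega>. \<forall>e\<in>cross A B. \<not> \<omega> e)"
      using sub fin L disj
      by (intro indep_Pr[OF J dR _ _ dC] finite_cross cross_subset_pairs) (auto intro: finite_subset)
    also have "\<dots> \<le> Pr (R x) * q ^ s\<^sup>2"
      using closed x by (intro mult_left_mono) (auto simp: AB)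
    finally show ?thesis by (simp add: AB)
  qed
  let ?K = "pairs (D \<union> E)"
  have K: "finite ?K" "?K \<subseteq> pairs L"
    using fin L by (auto intro!: finite_pairs pairs_mono)
  have JK: "?J \<subseteq> ?K"
    using pairs_mono[of D "D \<union> E"] pairs_mono[of E "D \<union> E"] by auto
  have dK: "depends_on ?K (\<lambda>\<omega>. R x \<omega> \<and> (\<forall>e\<in>cross (fst x) (snd x). \<not> \<omega> e))" if "x \<in> X" for x
  proof -
    have "fst x \<subseteq> D" "snd x \<subseteq> E" using that by (auto simp: X_def)
    then have "cross (fst x) (snd x) \<subseteq> ?K"
      using disj by (intro cross_subset_pairs) blast+
    then show ?thesis
      using JK by (intro depends_on_mono[OF depends_on_comp2[OF dR dC]]) blast
  qed
  have "Pr (\<lambda>\<omega>. \<sigma> \<omega> \<noteq> {} \<and> \<tau> \<omega> \<noteq> {} \<and> \<not> (\<exists>e\<in>cross (\<sigma> \<omega>) (\<tau> \<omega>). \<omega> e)) \<le>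
    Pr (\<lambda>\<omega>. \<exists>x\<in>X. R x \<omega> \<and> (\<forall>e\<in>cross (fst x) (snd x). \<not> \<omega> e))"
  proof (rule Pr_mono[OF K])
    show "depends_on ?K (\<lambda>\<omega>. \<exists>x\<in>X. R x \<omega> \<and> (\<forall>e\<in>cross (fst x) (snd x). \<not> \<omega> e))"
      using dK unfolding depends_on_def by blast
    show "\<exists>x\<in>X. R x \<omega> \<and> (\<forall>e\<in>cross (fst x) (snd x). \<not> \<omega> e)"
      if "\<sigma> \<omega> \<noteq> {} \<and> \<tau> \<omega> \<noteq> {} \<and> \<not> (\<exists>e\<in>cross (\<sigma> \<omega>) (\<tau> \<omega>). \<omega> e)" for \<omega>
      using that selects_subset[OF \<sigma>] selects_subset[OF \<tau>] \<sigma> \<tau>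
      by (intro bexI[of _ "(\<sigma> \<omega>, \<tau> \<omega>)"]) (auto simp: R_def X_def selects_def)
  qed
  also have "\<dots> \<le> (\<Sum>x\<in>X. Pr (\<lambda>\<omega>. R x \<omega> \<and> (\<forall>e\<in>cross (fst x) (snd x). \<not> \<omega> e)))"
    by (intro Pr_bex[OF K finX dK])
  also have "\<dots> \<le> (\<Sum>x\<in>X. Pr (R x) * q ^ s\<^sup>2)"
    by (intro sum_mono bound)
  also have "\<dots> = (\<Sum>x\<in>X. Pr (R x)) * q ^ s\<^sup>2"
    by (simp add: sum_distrib_right)
  also have "\<dots> \<le> 1 * q ^ s\<^sup>2"
    using q by (intro mult_right_mono sum_Pr_disjoint[OF J finX dR]) (auto simp: R_def)
  finally show ?thesis by simp
qed

lemma two_failures_bound: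
  assumes "finite D" "finite E" "D \<subseteq> L" "E \<subseteq> L" "D \<inter> E = {}"
    and "selects s D \<sigma>" "selects s E \<tau>"
    and "Pr (\<lambda>\<omega>. \<sigma> \<omega> = {}) \<le> r" "Pr (\<lambda>\<omega>. \<tau> \<omega> = {}) \<le> r"
  shows "Pr (\<lambda>\<omega>. \<sigma> \<omega> = {} \<and> \<tau> \<omega> = {}) \<le> r\<^sup>2"
proof -
  have "pairs D \<inter> pairs E = {}"
    using assms(5) by (fastforce simp: pairs_def doubleton_eq_iff)
  then have "Pr (\<lambda>\<omega>. \<sigma> \<omega> = {} \<and> \<tau> \<omega> = {}) = Pr (\<lambda>\<omega>. \<sigma> \<omega> = {}) * Pr (\<lambda>\<omega>. \<tau> \<omega> = {})"
    using assms by (intro indep_Pr[of "pairs D" _ "pairs E"])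
      (auto simp: selects_def intro!: finite_pairs pairs_mono intro: depends_on_comp)
  also have "\<dots> \<le> r * r"
    using assms order_trans[OF measure_nonneg assms(8)] by (intro mult_mono) auto
  finally show ?thesis by (simp add: power2_eq_square)
qed

text \<open>A union bound over ordered pairs of distinct blocks. A pair is harmful if both fail,
  which by independence costs \<open>r\<^sup>2\<close>, or if both succeed without being
  linked.\<close>

lemma not_merges_bound:
  assumes fin: "finite \<D>" "\<And>D. D \<in> \<D> \<Longrightarrow> finite D" and disj: "disjoint \<D>" and L: "\<Union>\<D> \<subseteq> L"
    and sel: "\<And>D. D \<in> \<D> \<Longrightarrow> selects s D (\<sigma> D)"
    and r: "\<And>D. D \<in> S \<Longrightarrow> D \<in> \<D> \<Longrightarrow> Pr (\<lambda>\<omega>. \<sigma> D \<omega> = {}) \<le> r"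
    and q: "0 \<le> q" "q \<le> 1" "\<And>u v. u \<in> \<Union>\<D> \<Longrightarrow> v \<in> \<Union>\<D> \<Longrightarrow> u \<noteq> v \<Longrightarrow> 1 - p {u, v} \<le> q"
  shows "Pr (\<lambda>\<omega>. \<not> merges \<D> S \<sigma> \<omega>) \<le> (real (card \<D>))\<^sup>2 * (r\<^sup>2 + q ^ s\<^sup>2)"
proof -
  let ?V = "\<Union>\<D>"
  have V: "finite (pairs ?V)" "pairs ?V \<subseteq> pairs L"
    using fin L by (auto intro!: finite_pairs pairs_mono)
  define X where "X = {(D, E). D \<in> \<D> \<and> E \<in> \<D> \<and> D \<noteq> E}"
  have X: "X \<subseteq> \<D> \<times> \<D>" by (auto simp: X_def)
  have finX: "finite X" using X fin by (auto intro: finite_subset)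
  define F where "F = (\<lambda>x \<omega>. fst x \<in> S \<and> snd x \<in> S \<and> \<sigma> (fst x) \<omega> = {} \<and> \<sigma> (snd x) \<omega> = {})"
  define G where "G = (\<lambda>x \<omega>. \<sigma> (fst x) \<omega> \<noteq> {} \<and> \<sigma> (snd x) \<omega> \<noteq> {} \<and>
      \<not> (\<exists>e\<in>cross (\<sigma> (fst x) \<omega>) (\<sigma> (snd x) \<omega>). \<omega> e))"
  have d1: "depends_on (pairs ?V) (\<sigma> D)" if "D \<in> \<D>" for D
    using sel that by (intro depends_on_selects) auto
  have d2: "depends_on (pairs ?V) (\<lambda>\<omega>. \<exists>e\<in>cross (\<sigma> D \<omega>) (\<sigma> E \<omega>). \<omega> e)"
    if "D \<in> \<D>" "E \<in> \<D>" "D \<noteq> E" for D E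
    using sel that disj by (intro depends_on_unlinked) (auto simp: disjoint_def)
  have dF: "depends_on (pairs ?V) (F x)" and dG: "depends_on (pairs ?V) (G x)" if "x \<in> X" for x
  proof -
    obtain D E where x: "x = (D, E)" "D \<in> \<D>" "E \<in> \<D>" "D \<noteq> E"
      using \<open>x \<in> X\<close> by (auto simp: X_def)
    show "depends_on (pairs ?V) (F x)"
    proof (rule depends_onI)
      fix \<omega> \<omega>' :: "'v set \<Rightarrow> bool" assume eq: "\<forall>e\<in>pairs ?V. \<omega> e = \<omega>' e"
      show "F x \<omega> = F x \<omega>'"
        using depends_onD[OF d1[OF x(2)] eq] depends_onD[OF d1[OF x(3)] eq] by (simp add: F_def x)
    qed
    show "depends_on (pairs ?V) (G x)"
    proof (rule depends_onI)
      fix \<omega> \<omega>' :: "'v set \<Rightarrow> bool" assume eq: "\<forall>e\<in>pairs ?V. \<omega> e = \<omega>' e"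
      show "G x \<omega> = G x \<omega>'"
        using depends_onD[OF d1[OF x(2)] eq] depends_onD[OF d1[OF x(3)] eq]
          depends_onD[OF d2[OF x(2-4)] eq]
        by (simp only: G_def x fst_conv snd_conv)
    qed
  qed
  have "Pr (\<lambda>\<omega>. \<not> merges \<D> S \<sigma> \<omega>) = Pr (\<lambda>\<omega>. \<exists>x\<in>X. F x \<omega> \<or> G x \<omega>)"
    by (rule arg_cong[where f = prob]) (auto simp: merges_def F_def G_def X_def)
  also have "\<dots> \<le> (\<Sum>x\<in>X. Pr (\<lambda>\<omega>. F x \<omega> \<or> G x \<omega>))"
    using depends_on_comp2[OF dF dG, of _ _ "(\<or>)"] by (intro Pr_bex[OF V finX]) simp
  also have "\<dots> \<le> (\<Sum>x\<in>X. r\<^sup>2 + q ^ s\<^sup>2)"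
  proof (rule sum_mono)
    fix x assume x: "x \<in> X"
    then obtain D E where DE: "x = (D, E)" "D \<in> \<D>" "E \<in> \<D>" "D \<noteq> E"
      by (auto simp: X_def)
    have D: "finite D" "finite E" "D \<subseteq> L" "E \<subseteq> L" "D \<inter> E = {}"
      using DE fin L disj by (auto simp: disjoint_def)
    have "Pr (\<lambda>\<omega>. F x \<omega> \<or> G x \<omega>) \<le> Pr (F x) + Pr (G x)"
      using x by (intro Pr_disj[OF V] dF dG)
    also have "Pr (F x) \<le> r\<^sup>2"
    \<comment> \<open>A double failure is charged only to two blocks of \<open>S\<close>; for other
      pairs \<open>F x\<close> is impossible.\<close>
    proof (cases "D \<in> S \<and> E \<in> S")
      case True
      then have "F x = (\<lambda>\<omega>. \<sigma> D \<omega> = {} \<and> \<sigma> E \<omega> = {})"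
        by (simp add: F_def DE)
      then show ?thesis
        using True DE two_failures_bound[OF D sel sel r r] by simp
    next
      case False
      then have "F x = (\<lambda>\<omega>. False)"
        by (auto simp add: F_def DE)
      then show ?thesis by simp
    qed
    also have "Pr (G x) \<le> q ^ s\<^sup>2"
      unfolding G_def DE fst_conv snd_conv using DE D q
      by (intro unlinked_bound[of D E] sel) blast+
    finally show "Pr (\<lambda>\<omega>. F x \<omega> \<or> G x \<omega>) \<le> r\<^sup>2 + q ^ s\<^sup>2" by simp
  qed
  also have "\<dots> = real (card X) * (r\<^sup>2 + q ^ s\<^sup>2)"
    by simp
  also have "card X \<le> (card \<D>)\<^sup>2"
    using card_mono[OF _ X] fin by (simp add: card_cartesian_product power2_eq_square)
  then have "real (card X) * (r\<^sup>2 + q ^ s\<^sup>2) \<le> real ((card \<D>)\<^sup>2) * (r\<^sup>2 + q ^ s\<^sup>2)"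
    using q by (intro mult_right_mono of_nat_mono) auto
  finally show ?thesis by simp
qed

text \<open>One renormalisation step for the existence of a large cluster: tolerating one bad
  subblock turns the failure probability \<open>r\<close> into a multiple of its square, plus the
  cost of missing links.\<close>

lemma block_step:
  assumes fin: "finite \<D>" "\<And>D. D \<in> \<D> \<Longrightarrow> finite D" and disj: "disjoint \<D>" and L: "\<Union>\<D> \<subseteq> L"
    and card: "2 \<le> card \<D>"
    and r: "\<And>D. D \<in> \<D> \<Longrightarrow> Pr (\<lambda>\<omega>. \<not> (\<exists>u\<in>D. s \<le> card (conn D \<omega> u))) \<le> r"
    and q: "0 \<le> q" "q \<le> 1" "\<And>u v. u \<in> \<Union>\<D> \<Longrightarrow> v \<in> \<Union>\<D> \<Longrightarrow> u \<noteq> v \<Longrightarrow> 1 - p {u, v} \<le> q"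
  shows "Pr (\<lambda>\<omega>. \<not> (\<exists>u\<in>\<Union>\<D>. (card \<D> - 1) * s \<le> card (conn (\<Union>\<D>) \<omega> u)))
    \<le> (real (card \<D>))\<^sup>2 * (r\<^sup>2 + q ^ s\<^sup>2)"
proof -
  have "\<forall>D. \<exists>\<sigma>. selects s D \<sigma> \<and> (\<forall>\<omega>. \<sigma> \<omega> = {} \<longrightarrow> \<not> (\<exists>u\<in>D :: 'v set. s \<le> card (conn D \<omega> u)))"
    by (intro allI ex_selects_large)
  then obtain \<sigma> :: "'v set \<Rightarrow> ('v set \<Rightarrow> bool) \<Rightarrow> 'v set" where \<sigma>: "\<And>D. selects s D (\<sigma> D)"
    "\<And>D \<omega>. \<sigma> D \<omega> = {} \<Longrightarrow> \<not> (\<exists>u\<in>D. s \<le> card (conn D \<omega> u))"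
    by (metis (no_types, lifting))
  have V: "finite (pairs (\<Union>\<D>))" "pairs (\<Union>\<D>) \<subseteq> pairs L"
    using fin L by (auto intro!: finite_pairs pairs_mono)
  have "Pr (\<lambda>\<omega>. \<not> (\<exists>u\<in>\<Union>\<D>. (card \<D> - 1) * s \<le> card (conn (\<Union>\<D>) \<omega> u)))
    \<le> Pr (\<lambda>\<omega>. \<not> merges \<D> \<D> \<sigma> \<omega>)"
  proof (rule Pr_mono[OF V])
    show "depends_on (pairs (\<Union>\<D>)) (\<lambda>\<omega>. \<not> merges \<D> \<D> \<sigma> \<omega>)"
      using \<sigma> disj by (intro depends_on_comp[OF depends_on_merges]) auto
    fix \<omega> assume *: "\<not> (\<exists>u\<in>\<Union>\<D>. (card \<D> - 1) * s \<le> card (conn (\<Union>\<D>) \<omega> u))"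
    show "\<not> merges \<D> \<D> \<sigma> \<omega>"
    proof
      assume m: "merges \<D> \<D> \<sigma> \<omega>"
      \<comment> \<open>Of two distinct blocks at least one succeeds, which supplies a cluster
        around which the others merge.\<close>
      obtain D E where "D \<in> \<D>" "E \<in> \<D>" "D \<noteq> E"
        using card by (metis card_le_Suc0_iff_eq fin(1) not_less_eq_eq numeral_2_eq_2)
      then obtain D0 u where "D0 \<in> \<D>" "u \<in> \<sigma> D0 \<omega>"
        using m unfolding merges_def by blast
      then show False
        using merged_cluster[OF fin disj _ m, of s D0 u] \<sigma>(1) * selects_subset by blast
    qed
  qed
  also have "\<dots> \<le> (real (card \<D>))\<^sup>2 * (r\<^sup>2 + q ^ s\<^sup>2)"
  proof (rule not_merges_bound[OF fin disj L \<sigma>(1)])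
    fix D assume D: "D \<in> \<D>"
    have "Pr (\<lambda>\<omega>. \<sigma> D \<omega> = {}) \<le> Pr (\<lambda>\<omega>. \<not> (\<exists>u\<in>D. s \<le> card (conn D \<omega> u)))"
    proof (rule Pr_mono)
      show "depends_on (pairs D) (\<lambda>\<omega>. \<not> (\<exists>u\<in>D. s \<le> card (conn D \<omega> u)))"
        using depends_on_conn[of D] unfolding depends_on_def by metis
    qed (use fin D L \<sigma>(2) in \<open>auto intro!: finite_pairs pairs_mono\<close>)
    with r[OF D] show "Pr (\<lambda>\<omega>. \<sigma> D \<omega> = {}) \<le> r" by simp
  qed (use q in auto)
  finally show ?thesis .
qed

text \<open>The same step for the cluster of a fixed vertex. The block of \<open>x\<close> cannot be
  the tolerated failure, so its failure probability is carried over linearly.\<close>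

lemma cluster_step:
  assumes fin: "finite \<D>" "\<And>D. D \<in> \<D> \<Longrightarrow> finite D" and disj: "disjoint \<D>" and L: "\<Union>\<D> \<subseteq> L"
    and x: "D0 \<in> \<D>" "x \<in> D0"
    and r: "\<And>D. D \<in> \<D> \<Longrightarrow> Pr (\<lambda>\<omega>. \<not> (\<exists>u\<in>D. s \<le> card (conn D \<omega> u))) \<le> r"
    and q: "0 \<le> q" "q \<le> 1" "\<And>u v. u \<in> \<Union>\<D> \<Longrightarrow> v \<in> \<Union>\<D> \<Longrightarrow> u \<noteq> v \<Longrightarrow> 1 - p {u, v} \<le> q"
  shows "Pr (\<lambda>\<omega>. \<not> (card \<D> - 1) * s \<le> card (conn (\<Union>\<D>) \<omega> x))
    \<le> Pr (\<lambda>\<omega>. \<not> s \<le> card (conn D0 \<omega> x)) + (real (card \<D>))\<^sup>2 * (r\<^sup>2 + q ^ s\<^sup>2)"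
proof -
  have "\<forall>D. \<exists>\<sigma>. selects s D \<sigma> \<and> (\<forall>\<omega>. \<sigma> \<omega> = {} \<longrightarrow> \<not> (\<exists>u\<in>D :: 'v set. s \<le> card (conn D \<omega> u)))"
    by (intro allI ex_selects_large)
  then obtain \<tau> :: "'v set \<Rightarrow> ('v set \<Rightarrow> bool) \<Rightarrow> 'v set" where \<tau>: "\<And>D. selects s D (\<tau> D)"
    "\<And>D \<omega>. \<tau> D \<omega> = {} \<Longrightarrow> \<not> (\<exists>u\<in>D. s \<le> card (conn D \<omega> u))"
    by (metis (no_types, lifting))
  define \<sigma> where "\<sigma> = \<tau>(D0 := (\<lambda>\<omega>. if s \<le> card (conn D0 \<omega> x) then conn D0 \<omega> x else {}))"
  have \<sigma>: "selects s D (\<sigma> D)" for D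
    using \<tau> selects_own[OF x(2)] by (simp add: \<sigma>_def)
  \<comment> \<open>The failure of \<open>D0\<close> is already charged to the first term of the
    bound, so only the other blocks count in double failures.\<close>
  let ?S = "\<D> - {D0}"
  have V: "finite (pairs (\<Union>\<D>))" "pairs (\<Union>\<D>) \<subseteq> pairs L"
    using fin L by (auto intro!: finite_pairs pairs_mono)
  have d1: "depends_on (pairs (\<Union>\<D>)) (\<lambda>\<omega>. \<not> merges \<D> ?S \<sigma> \<omega>)"
    using \<sigma> disj by (intro depends_on_comp[OF depends_on_merges]) auto
  have d2: "depends_on (pairs (\<Union>\<D>)) (\<lambda>\<omega>. \<not> s \<le> card (conn D0 \<omega> x))"
    using x by (intro depends_on_mono[OF depends_on_comp[OF depends_on_conn]] pairs_mono) auto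
  have "Pr (\<lambda>\<omega>. \<not> (card \<D> - 1) * s \<le> card (conn (\<Union>\<D>) \<omega> x))
    \<le> Pr (\<lambda>\<omega>. \<not> s \<le> card (conn D0 \<omega> x) \<or> \<not> merges \<D> ?S \<sigma> \<omega>)"
  proof (rule Pr_mono[OF V])
    show "depends_on (pairs (\<Union>\<D>)) (\<lambda>\<omega>. \<not> s \<le> card (conn D0 \<omega> x) \<or> \<not> merges \<D> ?S \<sigma> \<omega>)"
      using d1 d2 by (auto simp: depends_on_def)
    fix \<omega> assume *: "\<not> (card \<D> - 1) * s \<le> card (conn (\<Union>\<D>) \<omega> x)"
    show "\<not> s \<le> card (conn D0 \<omega> x) \<or> \<not> merges \<D> ?S \<sigma> \<omega>"
    proof (rule ccontr)
      assume "\<not> ?thesis"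
      then have m: "merges \<D> ?S \<sigma> \<omega>" and s: "s \<le> card (conn D0 \<omega> x)" by auto
      from s have "x \<in> \<sigma> D0 \<omega>" by (simp add: \<sigma>_def conn_refl)
      then show False
        using merged_cluster[OF fin disj _ m, of s D0 x] \<sigma> * x by blast
    qed
  qed
  also have "\<dots> \<le> Pr (\<lambda>\<omega>. \<not> s \<le> card (conn D0 \<omega> x)) + Pr (\<lambda>\<omega>. \<not> merges \<D> ?S \<sigma> \<omega>)"
    by (intro Pr_disj[OF V] d1 d2)
  also have "Pr (\<lambda>\<omega>. \<not> merges \<D> ?S \<sigma> \<omega>) \<le> (real (card \<D>))\<^sup>2 * (r\<^sup>2 + q ^ s\<^sup>2)"
  proof (rule not_merges_bound[OF fin disj L \<sigma>])
    fix D assume S: "D \<in> ?S" and D: "D \<in> \<D>"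
    have "Pr (\<lambda>\<omega>. \<sigma> D \<omega> = {}) \<le> Pr (\<lambda>\<omega>. \<not> (\<exists>u\<in>D. s \<le> card (conn D \<omega> u)))"
    proof (rule Pr_mono)
      show "depends_on (pairs D) (\<lambda>\<omega>. \<not> (\<exists>u\<in>D. s \<le> card (conn D \<omega> u)))"
        using depends_on_conn[of D] unfolding depends_on_def by metis
    qed (use fin S D L \<tau>(2) in \<open>auto simp: \<sigma>_def intro!: finite_pairs pairs_mono\<close>)
    with r[OF D] show "Pr (\<lambda>\<omega>. \<sigma> D \<omega> = {}) \<le> r" by simp
  qed (use q in auto)
  finally show ?thesis by simp
qed

end

section \<open>Balls of the hierarchical lattice\<close>

text \<open>The closed ball of radius \<open>n\<close>, written in coordinates (see
  \<open>in_hball_iff_dist\<close>), so that nesting and disjointness of ultrametric balls can be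
  read off directly.\<close>

definition hball :: "nat \<Rightarrow> (nat \<Rightarrow> nat) \<Rightarrow> nat \<Rightarrow> (nat \<Rightarrow> nat) set" where
  "hball N x n = {y \<in> hier_lattice N. \<forall>i>n. y i = x i}"

lemma vertex_pairs_eq: "vertex_pairs N = pairs (hier_lattice N)"
  by (simp add: vertex_pairs_def pairs_def)

lemma cluster_eq_conn: "cluster N \<omega> x = conn (hier_lattice N) \<omega> x"
  by (simp add: cluster_def conn_def vertex_pairs_eq)

text \<open>The terms of a convergent series tend to 0, and natural numbers below 1 vanish.\<close>

lemma hier_lattice_iff:
  "x \<in> hier_lattice N \<longleftrightarrow> x 0 = 0 \<and> (\<forall>i\<ge>1. x i < N) \<and> (\<exists>n. \<forall>i>n. x i = 0)"
proof -
  have "summable (\<lambda>i. real (x i)) \<longleftrightarrow> (\<exists>n. \<forall>i>n. x i = 0)"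
  proof
    assume "summable (\<lambda>i. real (x i))"
    then have "(\<lambda>i. real (x i)) \<longlonglongrightarrow> 0"
      by (rule summable_LIMSEQ_zero)
    then have "eventually (\<lambda>i. real (x i) < 1) sequentially"
      by (rule order_tendstoD) simp
    then obtain n where "\<And>i. i \<ge> n \<Longrightarrow> real (x i) < 1"
      by (auto simp: eventually_sequentially)
    then have "\<forall>i>n. x i = 0"
      by (metis less_imp_le less_one of_nat_1 of_nat_less_iff)
    then show "\<exists>n. \<forall>i>n. x i = 0" ..
  next
    assume "\<exists>n. \<forall>i>n. x i = 0"
    then obtain n where "\<forall>i>n. x i = 0" ..
    then show "summable (\<lambda>i. real (x i))"
      by (intro summable_finite[of "{..n}"]) (auto simp: not_le)
  qed
  then show ?thesis
    by (simp add: hier_lattice_def)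
qed

lemma zero_in_hier_lattice: "1 \<le> N \<Longrightarrow> (\<lambda>_. 0) \<in> hier_lattice N"
  by (simp add: hier_lattice_iff)

lemma finite_differences:
  assumes "x \<in> hier_lattice N" "y \<in> hier_lattice N"
  shows "finite {i. x i \<noteq> y i}"
proof -
  obtain m n where mn: "\<forall>i>m. x i = 0" "\<forall>i>n. y i = 0"
    using assms by (auto simp: hier_lattice_iff)
  have "{i. x i \<noteq> y i} \<subseteq> {..max m n}"
  proof
    fix i assume "i \<in> {i. x i \<noteq> y i}"
    then show "i \<in> {..max m n}"
      using mn[rule_format, of i] by (cases "i \<le> max m n") auto
  qed
  then show ?thesis by (rule finite_subset) simp
qed

lemma hball_subset: "hball N x n \<subseteq> hier_lattice N"
  by (auto simp: hball_def)

lemma hball_refl: "x \<in> hier_lattice N \<Longrightarrow> x \<in> hball N x n"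
  by (simp add: hball_def)

lemma hball_mono: "m \<le> n \<Longrightarrow> hball N x m \<subseteq> hball N x n"
  by (auto simp: hball_def)

lemma hball_eq: "y \<in> hball N x m \<Longrightarrow> m \<le> n \<Longrightarrow> hball N y n = hball N x n"
  by (auto simp: hball_def)

lemma hball_disjoint: "hball N x n \<noteq> hball N y n \<Longrightarrow> hball N x n \<inter> hball N y n = {}"
  by (auto simp: hball_def)

lemma in_hball_iff_dist:
  assumes "x \<in> hier_lattice N" "y \<in> hier_lattice N"
  shows "y \<in> hball N x n \<longleftrightarrow> hier_dist x y \<le> n"
proof (cases "x = y")
  case False
  then have "{i. x i \<noteq> y i} \<noteq> {}" by auto
  then show ?thesis
    using False assms finite_differences[OF assms]
    by (auto simp: hball_def hier_dist_def Max_le_iff not_le[symmetric] eq_commute)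
qed (use assms in \<open>simp add: hball_def hier_dist_def\<close>)

text \<open>The dummy coordinate 0 is fixed on the lattice, so radius 0 leaves no coordinate
  free.\<close>

lemma hball_0: "x \<in> hier_lattice N \<Longrightarrow> hball N x 0 = {x}"
  by (auto simp: hball_def hier_lattice_def fun_eq_iff) (metis gr0I)

lemma hball_Suc: "hball N x (Suc n) = (\<Union>a<N. hball N (x(Suc n := a)) n)"
proof
  show "(\<Union>a<N. hball N (x(Suc n := a)) n) \<subseteq> hball N x (Suc n)"
    by (auto simp: hball_def)
  show "hball N x (Suc n) \<subseteq> (\<Union>a<N. hball N (x(Suc n := a)) n)"
  proof
    fix y assume "y \<in> hball N x (Suc n)"
    then show "y \<in> (\<Union>a<N. hball N (x(Suc n := a)) n)"
      by (intro UN_I[of "y (Suc n)"]) (auto simp: hball_def hier_lattice_def)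
  qed
qed

lemma upd_in_hier_lattice: "x \<in> hier_lattice N \<Longrightarrow> a < N \<Longrightarrow> x(Suc n := a) \<in> hier_lattice N"
  unfolding hier_lattice_iff
proof (elim conjE exE, intro conjI)
  fix m assume "\<forall>i>m. x i = 0"
  then show "\<exists>k. \<forall>i>k. (x(Suc n := a)) i = 0"
    by (intro exI[of _ "max m (Suc n)"]) auto
qed auto

lemma card_hball: "x \<in> hier_lattice N \<Longrightarrow> finite (hball N x n) \<and> card (hball N x n) = N ^ n"
proof (induction n arbitrary: x)
  case 0
  then show ?case by (simp add: hball_0)
next
  case (Suc n)
  have *: "finite (hball N (x(Suc n := a)) n) \<and> card (hball N (x(Suc n := a)) n) = N ^ n" if "a < N" for a
    using Suc upd_in_hier_lattice that by blast
  have "card (hball N x (Suc n)) = (\<Sum>a<N. card (hball N (x(Suc n := a)) n))"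
    unfolding hball_Suc
  proof (intro card_UN_disjoint ballI impI)
    fix a b :: nat assume "a \<noteq> b"
    then show "hball N (x(Suc n := a)) n \<inter> hball N (x(Suc n := b)) n = {}"
      by (auto simp: hball_def dest!: spec[of _ "Suc n"])
  qed (use * in auto)
  then show ?case
    using * by (auto simp: hball_Suc)
qed

lemma finite_hball: "x \<in> hier_lattice N \<Longrightarrow> finite (hball N x n)"
  using card_hball by blast

lemma incseq_hball: "incseq (hball N x)"
  by (simp add: incseq_def hball_mono)

lemma UN_hball_0: "(\<Union>m. hball N (\<lambda>_. 0) m) = hier_lattice N"
  by (auto simp: hball_def) (auto simp: hier_lattice_iff)

text \<open>The sphere of radius k \<ge> 1 about any vertex has N^k - N^(k-1) points, the difference
  of two ball sizes; the induction adds one sphere at a time.\<close>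

lemma sum_shells:
  fixes f :: "nat \<Rightarrow> real"
  assumes "u \<in> hier_lattice N" "n \<le> m"
  shows "(\<Sum>v\<in>hball N u m - hball N u n. f (hier_dist u v)) =
    (\<Sum>k\<in>{n<..m}. (real N ^ k - real N ^ (k - 1)) * f k)"
  using assms(2)
proof (induction m rule: dec_induct)
  case base
  then show ?case by simp
next
  case (step m)
  have fin: "finite (hball N u k)" and card: "card (hball N u k) = N ^ k" for k
    using card_hball[OF assms(1)] by auto
  have sub: "hball N u n \<subseteq> hball N u m" "hball N u m \<subseteq> hball N u (Suc m)"
    using step by (auto intro!: hball_mono)
  have "hball N u (Suc m) - hball N u n = (hball N u (Suc m) - hball N u m) \<union> (hball N u m - hball N u n)"
    using sub by auto
  then have "(\<Sum>v\<in>hball N u (Suc m) - hball N u n. f (hier_dist u v)) =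
      (\<Sum>v\<in>hball N u (Suc m) - hball N u m. f (hier_dist u v)) +
      (\<Sum>v\<in>hball N u m - hball N u n. f (hier_dist u v))"
    using fin by (simp only:, intro sum.union_disjoint) auto
  also have "(\<Sum>v\<in>hball N u (Suc m) - hball N u m. f (hier_dist u v)) =
      (\<Sum>v\<in>hball N u (Suc m) - hball N u m. f (Suc m))"
  proof (rule sum.cong)
    fix v assume "v \<in> hball N u (Suc m) - hball N u m"
    then have "hier_dist u v = Suc m"
      using in_hball_iff_dist[OF assms(1), of v] hball_subset by (metis DiffE le_SucE subsetD)
    then show "f (hier_dist u v) = f (Suc m)" by simp
  qed simp
  also have "\<dots> = real (card (hball N u (Suc m) - hball N u m)) * f (Suc m)"
    by simp
  also have "card (hball N u (Suc m) - hball N u m) = N ^ Suc m - N ^ m"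
    using fin sub card by (simp add: card_Diff_subset)
  also have "real (N ^ Suc m - N ^ m) = real N ^ Suc m - real N ^ m"
    using card_mono[OF fin sub(2)] card by (simp add: of_nat_diff)
  moreover have "{n<..Suc m} = insert (Suc m) {n<..m}"
    using step(1) by auto
  ultimately show ?case
    using step.IH by simp
qed

definition subblocks :: "nat \<Rightarrow> (nat \<Rightarrow> nat) \<Rightarrow> nat \<Rightarrow> nat \<Rightarrow> (nat \<Rightarrow> nat) set set" where
  "subblocks N x n j = (\<lambda>y. hball N y n) ` hball N x (n + j)"

lemma subblocks:
  assumes "x \<in> hier_lattice N" "2 \<le> N"
  shows "finite (subblocks N x n j)" "disjoint (subblocks N x n j)"
    "\<Union>(subblocks N x n j) = hball N x (n + j)" "card (subblocks N x n j) = N ^ j"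
    "hball N x n \<in> subblocks N x n j"
    "\<And>D. D \<in> subblocks N x n j \<Longrightarrow> \<exists>y\<in>hier_lattice N. D = hball N y n"
proof -
  show fin: "finite (subblocks N x n j)"
    using assms finite_hball by (simp add: subblocks_def)
  show disj: "disjoint (subblocks N x n j)"
    using hball_disjoint by (auto simp: subblocks_def disjoint_def)
  show un: "\<Union>(subblocks N x n j) = hball N x (n + j)"
  proof
    show "\<Union>(subblocks N x n j) \<subseteq> hball N x (n + j)"
      using hball_mono[of n "n + j" N] hball_eq[of _ N x "n + j" "n + j"]
      by (fastforce simp: subblocks_def)
    show "hball N x (n + j) \<subseteq> \<Union>(subblocks N x n j)"
      using hball_refl hball_subset by (fastforce simp: subblocks_def)
  qed
  show ex: "\<exists>y\<in>hier_lattice N. D = hball N y n" if "D \<in> subblocks N x n j" for D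
    using that hball_subset unfolding subblocks_def by blast
  show "hball N x n \<in> subblocks N x n j"
    using hball_refl assms by (auto simp: subblocks_def)
  \<comment> \<open>The blocks are counted through their vertices: N^(n+j) vertices are split into
    blocks of N^n each.\<close>
  have "N ^ n * card (subblocks N x n j) = card (\<Union>(subblocks N x n j))"
  proof (rule card_partition)
    show "finite (\<Union>(subblocks N x n j))"
      using un finite_hball[OF assms(1)] by simp
    show "card D = N ^ n" if "D \<in> subblocks N x n j" for D
      using ex[OF that] card_hball by blast
  qed (use fin disj in \<open>auto simp: disjoint_def\<close>)
  then show "card (subblocks N x n j) = N ^ j"
    using assms card_hball[OF assms(1)] by (simp add: un power_add)
qed

section \<open>Long-range percolation on the hierarchical lattice\<close>

lemma conn_hier_lattice:
  "conn (hier_lattice N) \<omega> (\<lambda>_. 0) = (\<Union>m. conn (hball N (\<lambda>_. 0) m) \<omega> (\<lambda>_. 0))"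
  unfolding UN_hball_0[symmetric] by (rule conn_UN_incseq[OF incseq_hball])

text \<open>Expresses the event of an infinite cluster by countably many events about finite balls,
  which gives its measurability and the limits below.\<close>

lemma infinite_conn_iff:
  assumes "1 \<le> N"
  shows "infinite (conn (hier_lattice N) \<omega> (\<lambda>_. 0)) \<longleftrightarrow>
    (\<forall>k. \<exists>m. k \<le> card (conn (hball N (\<lambda>_. 0) m) \<omega> (\<lambda>_. 0)))" (is "infinite ?C \<longleftrightarrow> _")
proof
  let ?Cm = "\<lambda>m. conn (hball N (\<lambda>_. 0) m) \<omega> (\<lambda>_. 0)"
  have inc: "incseq ?Cm"
    by (auto simp: incseq_def intro!: conn_mono hball_mono)
  assume inf: "infinite ?C"
  show "\<forall>k. \<exists>m. k \<le> card (?Cm m)"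
  proof
    fix k
    obtain F where F: "F \<subseteq> ?C" "finite F" "card F = k"
      using infinite_arbitrarily_large[OF inf] by blast
    then have "F \<subseteq> (\<Union>m. ?Cm m)"
      by (simp add: conn_hier_lattice)
    then obtain m where "F \<subseteq> ?Cm m"
      using finite_subset_incseq[OF F(2) inc] by auto
    moreover have "finite (?Cm m)"
      using assms by (intro finite_subset[OF conn_subset] finite_hball hball_refl zero_in_hier_lattice)
    ultimately show "\<exists>m. k \<le> card (?Cm m)"
      using F card_mono by blast
  qed
next
  assume *: "\<forall>k. \<exists>m. k \<le> card (conn (hball N (\<lambda>_. 0) m) \<omega> (\<lambda>_. 0))"
  show "infinite ?C"
  proof
    assume "finite ?C"
    moreover obtain m where "Suc (card ?C) \<le> card (conn (hball N (\<lambda>_. 0) m) \<omega> (\<lambda>_. 0))"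
      using * by blast
    ultimately show False
      using card_mono[OF \<open>finite ?C\<close> conn_mono[OF hball_subset]] by (metis not_less_eq_eq)
  qed
qed

section \<open>The model, its infinite-cluster event and the edges leaving a ball\<close>

locale hier_percolation =
  fixes N :: nat and \<alpha> \<beta> :: real
  assumes N: "2 \<le> N" and \<alpha>: "0 \<le> \<alpha>" and \<beta>: "0 < \<beta>"

sublocale hier_percolation \<subseteq> random_graph "hier_lattice N" "\<lambda>e. edge_prob \<alpha> \<beta> (pair_dist e)"
  by unfold_locales (use \<alpha> \<beta> in \<open>auto simp: edge_prob_def\<close>)

context hier_percolation
begin

abbreviation origin :: "nat \<Rightarrow> nat" where "origin \<equiv> \<lambda>_. 0"

abbreviation L :: "(nat \<Rightarrow> nat) set" where "L \<equiv> hier_lattice N"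

abbreviation B :: "nat \<Rightarrow> (nat \<Rightarrow> nat) set" where "B \<equiv> hball N origin"

lemma origin: "origin \<in> L"
  using N by (intro zero_in_hier_lattice) simp

lemma perc_prob_eq: "perc_prob N \<alpha> \<beta> = Pr (\<lambda>\<omega>. infinite (conn L \<omega> origin))"
  by (simp add: perc_prob_def percolation_def cluster_eq_conn vertex_pairs_eq)

lemma finite_range_hball: "x \<in> L \<Longrightarrow> finite (pairs (hball N x n)) \<and> pairs (hball N x n) \<subseteq> pairs L"
  by (auto intro!: finite_pairs finite_hball pairs_mono[OF hball_subset])

lemmas finite_range_B = conjunct1[OF finite_range_hball[OF origin]] conjunct2[OF finite_range_hball[OF origin]]

lemma events_large: "{\<omega> \<in> space \<PP>. k \<le> card (conn (B m) \<omega> origin)} \<in> events"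
  by (rule depends_on_measurable[OF finite_range_B depends_on_comp[OF depends_on_conn]])

lemma events_ex_large: "{\<omega> \<in> space \<PP>. \<exists>m. k \<le> card (conn (B m) \<omega> origin)} \<in> events"
  by (intro sets.sets_Collect_countable_Ex events_large)

lemma events_infinite: "{\<omega> \<in> space \<PP>. infinite (conn L \<omega> origin)} \<in> events"
proof -
  have "1 \<le> N" using N by simp
  then show ?thesis
    unfolding infinite_conn_iff[OF \<open>1 \<le> N\<close>]
    by (intro sets.sets_Collect_countable_All events_ex_large)
qed

text \<open>Common frame of the two non-percolation proofs: cover the event by an increasing
  sequence of finite-range events. The window \<open>h m\<close> may exceed \<open>m\<close>,
  because \<open>P m\<close> may also concern balls of a fixed larger radius.\<close>

lemma Pr_infinite_le:
  fixes P :: "nat \<Rightarrow> ((nat \<Rightarrow> nat) set \<Rightarrow> bool) \<Rightarrow> bool"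
  assumes "\<And>\<omega>. infinite (conn L \<omega> origin) \<Longrightarrow> \<exists>m. P m \<omega>"
    and "\<And>m. depends_on (pairs (B (h m))) (P m)" and mono: "\<And>\<omega> m n. m \<le> n \<Longrightarrow> P m \<omega> \<Longrightarrow> P n \<omega>"
    and "\<And>m. m \<ge> l \<Longrightarrow> Pr (P m) \<le> c"
  shows "Pr (\<lambda>\<omega>. infinite (conn L \<omega> origin)) \<le> c"
proof -
  have "{\<omega> \<in> space \<PP>. \<exists>m. P m \<omega>} \<in> events"
    by (intro sets.sets_Collect_countable_Ex depends_on_measurable[OF finite_range_B assms(2)])
  then have "Pr (\<lambda>\<omega>. infinite (conn L \<omega> origin)) \<le> Pr (\<lambda>\<omega>. \<exists>m. P m \<omega>)"
    using assms(1) by (intro finite_measure_mono) auto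
  also have "\<dots> \<le> c"
    using assms(2-4) finite_range_B by (intro Pr_ex_mono_le[where J = "\<lambda>m. pairs (B (h m))" and l = l]) auto
  finally show ?thesis .
qed

text \<open>Continuity from above in \<open>k\<close>; the radius \<open>m\<close> may depend on
  \<open>k\<close>, only the bound \<open>c\<close> must be uniform.\<close>

lemma Pr_infinite_ge:
  assumes "\<And>k. \<exists>m. c \<le> Pr (\<lambda>\<omega>. k \<le> card (conn (B m) \<omega> origin))"
  shows "c \<le> Pr (\<lambda>\<omega>. infinite (conn L \<omega> origin))"
proof -
  let ?A = "\<lambda>k. {\<omega> \<in> space \<PP>. \<exists>m. k \<le> card (conn (B m) \<omega> origin)}"
  have "(\<lambda>k. prob (?A k)) \<longlonglongrightarrow> prob (\<Inter>k. ?A k)"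
    using events_ex_large by (intro finite_Lim_measure_decseq) (auto simp: decseq_def intro: order_trans)
  moreover have "c \<le> prob (?A k)" for k
  proof -
    obtain m where "c \<le> Pr (\<lambda>\<omega>. k \<le> card (conn (B m) \<omega> origin))"
      using assms by blast
    also have "\<dots> \<le> prob (?A k)"
      by (intro finite_measure_mono events_ex_large) auto
    finally show ?thesis .
  qed
  ultimately have "c \<le> prob (\<Inter>k. ?A k)"
    by (intro LIMSEQ_le_const) auto
  also have "(\<Inter>k. ?A k) = {\<omega> \<in> space \<PP>. infinite (conn L \<omega> origin)}"
    using N by (subst infinite_conn_iff) auto
  finally show ?thesis .
qed

text \<open>Multiplied by \<alpha>, this is the sum of the exponents \<alpha> / \<beta>^k over all
  vertices whose distance k from a given vertex satisfies n < k \<le> m.\<close>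

definition shells :: "nat \<Rightarrow> nat \<Rightarrow> real" where
  "shells n m = (\<Sum>k\<in>{n<..m}. (real N ^ k - real N ^ (k - 1)) / \<beta> ^ k)"

text \<open>With \<open>n' = n\<close> these are all edges from \<open>B n\<close> to the rest of
  \<open>B m\<close>; with \<open>n' > n\<close>, only those that jump over the gap between the two
  radii.\<close>

definition escape :: "nat \<Rightarrow> nat \<Rightarrow> nat \<Rightarrow> (nat \<Rightarrow> nat) set set" where
  "escape n n' m = cross (B n) (B m - B n')"

lemma escape:
  assumes "n \<le> n'"
  shows "finite (escape n n' m)" "escape n n' m \<subseteq> pairs L" 
proof -
  have d: "B n \<inter> (B m - B n') = {}"
    using hball_mono[OF assms] by blast
  show "finite (escape n n' m)"
    unfolding escape_def using origin by (intro finite_cross finite_Diff finite_hball)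
  show "escape n n' m \<subseteq> pairs L"
    unfolding escape_def using d hball_subset by (intro cross_subset_pairs) blast+
qed

lemma sum_escape:
  assumes "n \<le> n'" "n' \<le> m"
  shows "(\<Sum>e\<in>escape n n' m. \<alpha> / \<beta> ^ pair_dist e) = \<alpha> * real N ^ n * shells n' m"
proof -
  have d: "B n \<inter> (B m - B n') = {}"
    using hball_mono[OF assms(1)] by blast
  have "(\<Sum>v\<in>B m - B n'. \<alpha> / \<beta> ^ hier_dist u v) = \<alpha> * shells n' m" if u: "u \<in> B n" for u
  proof -
    have "hball N u m = B m" "hball N u n' = B n'"
      using hball_eq[OF u, of m] hball_eq[OF u, of n'] assms by simp_all
    moreover have "u \<in> L"
      using u hball_subset by blast
    ultimately have "(\<Sum>v\<in>B m - B n'. \<alpha> / \<beta> ^ hier_dist u v) =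
        (\<Sum>k\<in>{n'<..m}. (real N ^ k - real N ^ (k - 1)) * (\<alpha> / \<beta> ^ k))"
      using sum_shells[OF \<open>u \<in> L\<close> assms(2), of "\<lambda>k. \<alpha> / \<beta> ^ k"] by simp
    then show ?thesis
      by (simp add: shells_def sum_distrib_left mult_ac)
  qed
  then show ?thesis
    using card_hball[OF origin, of n] by (simp add: escape_def sum_cross[OF d] pair_dist_doubleton)
qed

text \<open>Each edge is closed with an exponential probability, so independence turns the product
  into the exponential of a sum over shells.\<close>

lemma Pr_escape_closed:
  assumes "n \<le> n'" "n' \<le> m"
  shows "Pr (\<lambda>\<omega>. \<forall>e\<in>escape n n' m. \<not> \<omega> e) = exp (- (\<alpha> * real N ^ n * shells n' m))"
proof -
  have "Pr (\<lambda>\<omega>. \<forall>e\<in>escape n n' m. \<not> \<omega> e) = (\<Prod>e\<in>escape n n' m. exp (- (\<alpha> / \<beta> ^ pair_dist e)))"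
    using escape[OF assms(1)] by (subst Pr_all_closed) (auto simp: edge_prob_def)
  also have "\<dots> = exp (- (\<Sum>e\<in>escape n n' m. \<alpha> / \<beta> ^ pair_dist e))"
    using escape[OF assms(1)] by (subst exp_sum[symmetric]) (auto simp: sum_negf)
  finally show ?thesis
    by (simp add: sum_escape[OF assms])
qed

lemma Pr_escape_open:
  assumes "n \<le> n'" "n' \<le> m"
  shows "Pr (\<lambda>\<omega>. \<exists>e\<in>escape n n' m. \<omega> e) \<le> \<alpha> * real N ^ n * shells n' m"
proof -
  have "Pr (\<lambda>\<omega>. \<exists>e\<in>escape n n' m. \<omega> e) \<le> (\<Sum>e\<in>escape n n' m. edge_prob \<alpha> \<beta> (pair_dist e))"
    using escape[OF assms(1)] by (intro Pr_exists_open)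
  also have "\<dots> \<le> (\<Sum>e\<in>escape n n' m. \<alpha> / \<beta> ^ pair_dist e)"
  proof (rule sum_mono)
    fix e
    show "edge_prob \<alpha> \<beta> (pair_dist e) \<le> \<alpha> / \<beta> ^ pair_dist e"
      using exp_ge_add_one_self[of "- (\<alpha> / \<beta> ^ pair_dist e)"] unfolding edge_prob_def by linarith
  qed
  finally show ?thesis
    by (simp add: sum_escape[OF assms])
qed

section \<open>The regimes of the parameter\<close>

lemma shells_le:
  "shells n m \<le> (\<Sum>k\<in>{n<..m}. (real N / \<beta>) ^ k)"
  unfolding shells_def using \<beta> by (intro sum_mono) (auto simp: power_divide divide_right_mono)

lemma percolates_low:
  assumes "\<beta> \<le> N" "0 < \<alpha>"
  shows "perc_prob N \<alpha> \<beta> = 1"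
proof -
  \<comment> \<open>At least half of the N^k points of a ball of radius k lie at distance exactly k
    from its centre, and \<beta>^k \<le> N^k; so each sphere contributes at least 1/2 and the sum
    diverges.\<close>
  have shells: "real (m - n) / 2 \<le> shells n m" for n m
  proof -
    have "real (m - n) / 2 = (\<Sum>k\<in>{n<..m}. 1 / 2)"
      by simp
    also have "\<dots> \<le> shells n m"
      unfolding shells_def
    proof (rule sum_mono)
      fix k assume "k \<in> {n<..m}"
      then obtain l where l: "k = Suc l" by (cases k) auto
      have "\<beta> ^ k \<le> real N ^ k" using assms \<beta> by (intro power_mono) auto
      also have "real N ^ k \<le> 2 * (real N ^ k - real N ^ (k - 1))"
        using N by (auto simp: l algebra_simps intro!: mult_right_mono)
      finally show "1 / 2 \<le> (real N ^ k - real N ^ (k - 1)) / \<beta> ^ k"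
        using \<beta> by (simp add: field_simps)
    qed
    finally show ?thesis .
  qed
  have meas: "{\<omega> \<in> space \<PP>. \<forall>e\<in>escape 0 n m. \<not> \<omega> e} \<in> events" for n m
    using escape[of 0 n m] by (intro depends_on_measurable[of "escape 0 n m"]) (auto simp: depends_on_def)
  have "AE \<omega> in \<PP>. \<forall>n. \<exists>m. \<exists>e\<in>escape 0 n m. \<omega> e"
  proof (rule AE_all_countable[THEN iffD2], rule allI)
    fix n
    let ?A = "{\<omega> \<in> space \<PP>. \<forall>m. \<forall>e\<in>escape 0 n m. \<not> \<omega> e}"
    have A: "?A \<in> events"
      by (intro sets.sets_Collect_countable_All meas)
    have "prob ?A \<le> exp (- (\<alpha> / 2) * real m)" for m
    proof -
      have "prob ?A \<le> Pr (\<lambda>\<omega>. \<forall>e\<in>escape 0 n (n + m). \<not> \<omega> e)"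
        by (intro finite_measure_mono meas) auto
      also have "\<dots> = exp (- (\<alpha> * shells n (n + m)))"
        by (subst Pr_escape_closed) auto
      also have "\<dots> \<le> exp (- (\<alpha> / 2) * real m)"
        using mult_left_mono[OF shells[of "n + m" n], of \<alpha>] assms by simp
      finally show ?thesis .
    qed
    moreover have "(\<lambda>m. exp (- (\<alpha> / 2) * real m)) \<longlonglongrightarrow> 0"
      using assms by real_asymp
    ultimately have "prob ?A \<le> 0"
      by (intro LIMSEQ_le_const) auto
    then have "prob ?A = 0"
      by (simp add: measure_le_0_iff)
    then have "AE \<omega> in \<PP>. \<omega> \<notin> ?A"
      using A by (intro AE_not_in) (simp add: null_sets_def emeasure_eq_measure)
    then show "AE \<omega> in \<PP>. \<exists>m. \<exists>e\<in>escape 0 n m. \<omega> e"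
      by (rule AE_mp) (auto intro!: AE_I2)
  qed
  \<comment> \<open>As \<open>B 0\<close> is the singleton of the origin,
    \<open>escape 0 n m\<close> consists of edges at the origin; a finite cluster would lie in some
    ball and contradict an open edge leaving it.\<close>
  moreover have "infinite (conn L \<omega> origin)" if *: "\<forall>n. \<exists>m. \<exists>e\<in>escape 0 n m. \<omega> e" for \<omega>
  proof
    assume fin: "finite (conn L \<omega> origin)"
    moreover have "conn L \<omega> origin \<subseteq> (\<Union>m. B m)"
      using conn_subset[OF origin] by (simp add: UN_hball_0)
    ultimately obtain n where n: "conn L \<omega> origin \<subseteq> B n"
      using finite_subset_incseq[OF _ incseq_hball] by blast
    obtain m e where e: "e \<in> escape 0 n m" "\<omega> e"
      using * by blast
    then have "\<exists>v\<in>L. e = {origin, v} \<and> v \<notin> B n"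
      using hball_subset[of N origin m] by (auto simp: escape_def cross_def hball_0[OF origin])
    then obtain v where v: "e = {origin, v}" "v \<in> L" "v \<notin> B n"
      by blast
    have "v \<noteq> origin"
      using v hball_refl[OF origin, of n] by auto
    then have "v \<in> conn L \<omega> origin"
      using e v origin by (intro conn_edge) (auto simp: pairs_iff)
    with n v show False by blast
  qed
  ultimately have "AE \<omega> in \<PP>. infinite (conn L \<omega> origin)"
    by (auto elim: AE_mp)
  then show ?thesis
    unfolding perc_prob_eq using prob_Collect_eq_1[OF events_infinite] by blast
qed

text \<open>The expected degree is at most \<alpha> times the geometric series in N / \<beta>, that
  is \<alpha> N / (\<beta> - N), and the hypothesis places this below 1. The resulting bound on the
  expected cluster size is uniform in the ball, so Markov's inequality lets the size threshold tend
  to infinity.\<close>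

lemma subcritical:
  assumes "real N < \<beta>" "\<alpha> * real N < \<beta> - real N"
  shows "perc_prob N \<alpha> \<beta> = 0"
proof -
  let ?r = "real N / \<beta>"
  have r: "0 < ?r" "?r < 1" using N \<beta> assms by auto
  define \<rho> where "\<rho> = \<alpha> * (?r / (1 - ?r))"
  have "?r / (1 - ?r) = real N / (\<beta> - real N)"
    using assms \<beta> by (simp add: field_simps)
  then have \<rho>: "\<rho> < 1"
    using assms by (simp add: \<rho>_def field_simps)
  have degree: "(\<Sum>v\<in>B m - {u}. edge_prob \<alpha> \<beta> (pair_dist {u, v})) \<le> \<rho>" if u: "u \<in> B m" for u m
  proof -
    have uL: "u \<in> L" using u hball_subset by blast
    have "(\<Sum>v\<in>B m - {u}. edge_prob \<alpha> \<beta> (pair_dist {u, v})) \<le> (\<Sum>v\<in>B m - {u}. \<alpha> / \<beta> ^ hier_dist u v)"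
    proof (rule sum_mono)
      fix v
      show "edge_prob \<alpha> \<beta> (pair_dist {u, v}) \<le> \<alpha> / \<beta> ^ hier_dist u v"
        using exp_ge_add_one_self[of "- (\<alpha> / \<beta> ^ hier_dist u v)"]
        unfolding edge_prob_def pair_dist_doubleton by linarith
    qed
    also have "\<dots> = (\<Sum>v\<in>hball N u m - hball N u 0. \<alpha> / \<beta> ^ hier_dist u v)"
      using hball_eq[OF u order_refl] hball_0[OF uL] by simp
    also have "\<dots> = \<alpha> * shells 0 m"
      by (simp add: sum_shells[OF uL, of 0 m "\<lambda>k. \<alpha> / \<beta> ^ k"] shells_def sum_distrib_left mult_ac)
    also have "shells 0 m \<le> (\<Sum>k\<in>{0<..m}. ?r ^ k)"
      by (rule shells_le)
    also have "(\<Sum>k\<in>{0<..m}. ?r ^ k) = (\<Sum>k<m. ?r * ?r ^ k)"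
      by (rule sum.reindex_bij_witness[of _ Suc "\<lambda>k. k - 1"]) (auto simp: power_Suc[symmetric] simp del: power_Suc)
    also have "\<dots> \<le> (\<Sum>k. ?r * ?r ^ k)"
      using r N \<beta> by (intro sum_le_suminf summable_mult summable_geometric) auto
    also have "\<dots> = ?r / (1 - ?r)"
      using r by (subst suminf_mult) (simp_all add: summable_geometric suminf_geometric)
    finally show ?thesis
      using \<alpha> by (simp add: \<rho>_def mult_left_mono)
  qed
  have bound: "Pr (\<lambda>\<omega>. k \<le> card (conn (B m) \<omega> origin)) \<le> (1 / (1 - \<rho>)) / real k" if "0 < k" for k m
  proof -
    have "real k * Pr (\<lambda>\<omega>. k \<le> card (conn (B m) \<omega> origin)) \<le> (\<Sum>y\<in>B m. Pr (\<lambda>\<omega>. y \<in> conn (B m) \<omega> origin))"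
      using origin by (intro large_cluster_markov finite_hball hball_subset hball_refl)
    also have "\<dots> \<le> 1 / (1 - \<rho>)"
      using origin \<rho> degree by (intro expected_cluster_bound finite_hball hball_subset hball_refl) auto
    finally show ?thesis
      using that by (subst pos_le_divide_eq) (simp_all add: mult.commute)
  qed
  have "perc_prob N \<alpha> \<beta> \<le> (1 / (1 - \<rho>)) / real (Suc k)" for k
    unfolding perc_prob_eq
  proof (rule Pr_infinite_le[where h = "\<lambda>m. m" and l = 0])
    show "\<exists>m. Suc k \<le> card (conn (B m) \<omega> origin)" if "infinite (conn L \<omega> origin)" for \<omega>
      using that N by (subst (asm) infinite_conn_iff) auto
    show "Suc k \<le> card (conn (B n) \<omega> origin)" if "m \<le> n" "Suc k \<le> card (conn (B m) \<omega> origin)" for \<omega> m n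
    proof -
      have "card (conn (B m) \<omega> origin) \<le> card (conn (B n) \<omega> origin)"
        using that origin
        by (intro card_mono finite_subset[OF conn_subset] conn_mono hball_mono hball_refl finite_hball) 
      with that show ?thesis by simp
    qed
    show "Pr (\<lambda>\<omega>. Suc k \<le> card (conn (B m) \<omega> origin)) \<le> (1 / (1 - \<rho>)) / real (Suc k)" for m
      by (rule bound) simp
  qed (rule depends_on_comp[OF depends_on_conn])
  moreover have "(\<lambda>k. (1 / (1 - \<rho>)) / real (Suc k)) \<longlonglongrightarrow> 0"
    by real_asymp
  ultimately have "perc_prob N \<alpha> \<beta> \<le> 0"
    by (intro LIMSEQ_le_const) auto
  then show ?thesis
    by (simp add: perc_prob_def measure_le_0_iff)
qed

text \<open>Take the scales \<open>j * l\<close> for \<open>j < J\<close>. In an infinite cluster, for every \<open>j\<close> an open edge leaves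
  \<open>B (j * l)\<close>. Up to an event of probability \<open>O (J / N ^ l)\<close> it ends inside \<open>B (Suc j * l)\<close>, and these
  \<open>J\<close> events are independent with probability at most \<open>1 - exp (- \<alpha>)\<close> each.\<close>

lemma no_percolation_high:
  assumes "(real N)\<^sup>2 \<le> \<beta>"
  shows "perc_prob N \<alpha> \<beta> = 0"
proof -
  \<comment> \<open>Here N / \<beta> \<le> 1 / N. The N^n vertices of \<open>B n\<close> thus carry
    a total escape weight of at most \<alpha>, whatever the radius.\<close>
  have shells: "shells n m \<le> 1 / real N ^ n" if "n \<le> m" for n m
  proof -
    have "shells n m \<le> (\<Sum>k\<in>{n<..m}. (real N / \<beta>) ^ k)"
      by (rule shells_le)
    also have "\<dots> \<le> (\<Sum>k\<in>{n<..m}. (1 / real N) ^ k)"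
      using assms \<beta> N by (intro sum_mono power_mono) (auto simp: field_simps power2_eq_square)
    also have "\<dots> \<le> 1 / real N ^ n - 1 / real N ^ m"
      using that
    proof (induction m rule: dec_induct)
      case (step m)
      \<comment> \<open>The geometric sum is dominated by a telescoping one, which works because N
        \<ge> 2.\<close>
      have "{n<..Suc m} = insert (Suc m) {n<..m}"
        using step(1) by auto
      moreover have "(1 / real N) ^ Suc m \<le> 1 / real N ^ m - 1 / real N ^ Suc m"
        using N by (simp add: field_simps)
      ultimately show ?case using step.IH by simp
    qed simp
    also have "\<dots> \<le> 1 / real N ^ n" by simp
    finally show ?thesis .
  qed
  define c where "c = 1 - exp (- \<alpha>)"
  have c: "0 \<le> c" "c < 1" using \<alpha> by (auto simp: c_def)
  have bound: "perc_prob N \<alpha> \<beta> \<le> c ^ J + real J * (\<alpha> / real N ^ l)" for J l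
  proof -
    define S where "S = (\<lambda>j \<omega>. \<exists>e\<in>escape (j * l) (j * l) (Suc j * l). \<omega> e)"
    define T where "T = (\<lambda>m j \<omega>. \<exists>e\<in>escape (j * l) (Suc j * l) m. \<omega> e)"
    have le: "j * l \<le> Suc j * l" for j by simp
    have dS: "depends_on (escape (j * l) (j * l) (Suc j * l)) (S j)" for j
      unfolding S_def by (rule depends_on_open)
    have dT: "depends_on (escape (j * l) (Suc j * l) m) (T m j)" for j m
      unfolding T_def by (rule depends_on_open)
    have sub: "escape n n' m \<subseteq> pairs (B k)" if "n \<le> n'" "n \<le> k" "m \<le> k" for n n' m k
    proof -
      have "B n \<inter> (B m - B n') = {}" "B n \<subseteq> B k" "B m \<subseteq> B k"
        using that hball_mono[of _ _ N origin] by blast+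
      then show ?thesis
        unfolding escape_def by (intro cross_subset_pairs) auto
    qed
    have PS: "Pr (S j) \<le> c" for j
    proof -
      have "Pr (\<lambda>\<omega>. \<forall>e\<in>escape (j * l) (j * l) (Suc j * l). \<not> \<omega> e) =
          exp (- (\<alpha> * real N ^ (j * l) * shells (j * l) (Suc j * l)))"
        by (intro Pr_escape_closed) auto
      moreover have "exp (- \<alpha>) \<le> exp (- (\<alpha> * real N ^ (j * l) * shells (j * l) (Suc j * l)))"
        using mult_left_mono[OF shells[OF le[of j]], of "\<alpha> * real N ^ (j * l)"] \<alpha> N by simp
      moreover have "Pr (\<lambda>\<omega>. \<not> (\<forall>e\<in>escape (j * l) (j * l) (Suc j * l). \<not> \<omega> e)) =
          1 - Pr (\<lambda>\<omega>. \<forall>e\<in>escape (j * l) (j * l) (Suc j * l). \<not> \<omega> e)"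
        using escape[of "j * l" "j * l" "Suc j * l"]
        by (intro Pr_not) (auto simp: depends_on_def)
      ultimately show ?thesis
        by (simp add: S_def c_def)
    qed
    have dall: "depends_on (pairs (B (i * l))) (\<lambda>\<omega>. \<forall>j<i. S j \<omega>)" for i
    proof -
      have "depends_on (pairs (B (i * l))) (S j)" if "j < i" for j
      proof (rule depends_on_mono[OF dS])
        have "Suc j * l \<le> i * l" "j * l \<le> i * l" using that by (intro mult_le_mono1, simp)+
        then show "escape (j * l) (j * l) (Suc j * l) \<subseteq> pairs (B (i * l))"
          by (intro sub order_refl)
      qed
      then have "depends_on (pairs (B (i * l))) (\<lambda>\<omega>. \<forall>j\<in>{..<i}. S j \<omega>)"
        by (intro depends_on_ball) auto
      then show ?thesis by (simp only: Ball_def lessThan_iff)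
    qed
    have all: "Pr (\<lambda>\<omega>. \<forall>j<i. S j \<omega>) \<le> c ^ i" for i
    proof (induction i)
      case (Suc i)
      \<comment> \<open>All earlier events are decided inside \<open>B (i * l)\<close>, while
        \<open>S i\<close> concerns edges leaving that ball.\<close>
      have "pairs (B (i * l)) \<inter> escape (i * l) (i * l) (Suc i * l) = {}"
        by (auto simp: escape_def cross_def pairs_iff)
      then have "Pr (\<lambda>\<omega>. (\<forall>j<i. S j \<omega>) \<and> S i \<omega>) = Pr (\<lambda>\<omega>. \<forall>j<i. S j \<omega>) * Pr (S i)"
        using escape[of "i * l" "i * l"] by (intro indep_Pr[OF finite_range_B dall _ _ dS]) auto
      also have "\<dots> \<le> c ^ i * c"
        using c by (intro mult_mono Suc PS) auto
      finally show ?case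
        by (simp add: less_Suc_eq all_conj_distrib imp_conjR conj_commute mult.commute)
    qed simp
    have PT: "Pr (T m j) \<le> \<alpha> / real N ^ l" if "Suc j * l \<le> m" for m j
    proof -
      have "Pr (T m j) \<le> \<alpha> * real N ^ (j * l) * shells (Suc j * l) m"
        unfolding T_def using that by (intro Pr_escape_open) auto
      \<comment> \<open>N^(j l) starting points, each with weight N^(-(j+1) l) beyond the gap:
        jumping over \<open>l\<close> levels gains a factor N^(-l).\<close>
      also have "\<dots> \<le> \<alpha> * real N ^ (j * l) * (1 / real N ^ (Suc j * l))"
        using \<alpha> N by (intro mult_left_mono shells that) auto
      also have "\<dots> = \<alpha> / real N ^ l"
        using N by (simp add: power_add field_simps)
      finally show ?thesis .
    qed
    show ?thesis
      unfolding perc_prob_eq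
    proof (rule Pr_infinite_le[where h = "\<lambda>m. max m (J * l)" and l = "J * l"
          and P = "\<lambda>m \<omega>. \<forall>j\<in>{..<J}. \<exists>e\<in>escape (j * l) (j * l) m. \<omega> e"])
      fix \<omega> assume inf: "infinite (conn L \<omega> origin)"
      have "\<exists>m. \<exists>e\<in>escape n n m. \<omega> e" for n
      proof (rule ccontr)
        assume no: "\<not> ?thesis"
        have "conn L \<omega> origin \<subseteq> B n"
        proof (rule conn_subset_closed)
          fix u v assume uv: "u \<in> B n" "v \<in> L - B n"
          then obtain m where "v \<in> B m" using UN_hball_0[of N] by blast
          then have "{u, v} \<in> escape n n m"
            using uv by (auto simp: escape_def cross_def)
          then show "\<not> \<omega> {u, v}" using no by blast
        qed (simp add: hball_refl origin)
        then show False
          using inf finite_hball[OF origin] finite_subset by blast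
      qed
      then obtain f where f: "\<exists>e\<in>escape n n (f n). \<omega> e" for n by metis
      \<comment> \<open>One radius serves all \<open>J\<close> scales, because the escape sets grow
        with the radius.\<close>
      define m where "m = Max ((\<lambda>j. f (j * l)) ` {..<J})"
      have "\<exists>e\<in>escape (j * l) (j * l) m. \<omega> e" if "j \<in> {..<J}" for j
      proof -
        have "f (j * l) \<le> m" using that by (auto simp: m_def)
        then have "escape (j * l) (j * l) (f (j * l)) \<subseteq> escape (j * l) (j * l) m"
          using hball_mono[of "f (j * l)" m N origin] by (auto simp: escape_def cross_def)
        then show ?thesis using f by blast
      qed
      then show "\<exists>m. \<forall>j\<in>{..<J}. \<exists>e\<in>escape (j * l) (j * l) m. \<omega> e" by blast
    next
      fix m
      show "depends_on (pairs (B (max m (J * l)))) (\<lambda>\<omega>. \<forall>j\<in>{..<J}. \<exists>e\<in>escape (j * l) (j * l) m. \<omega> e)"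
      proof (rule depends_on_ball)
        fix j assume "j \<in> {..<J}"
        then have "j * l \<le> max m (J * l)"
          by (intro max.coboundedI2 mult_le_mono1) simp
        then show "depends_on (pairs (B (max m (J * l)))) (\<lambda>\<omega>. \<exists>e\<in>escape (j * l) (j * l) m. \<omega> e)"
          by (intro depends_on_mono[OF depends_on_open] sub order_refl max.cobounded1)
      qed
    next
      fix \<omega> m m' assume "m \<le> (m' :: nat)" and *: "\<forall>j\<in>{..<J}. \<exists>e\<in>escape (j * l) (j * l) m. \<omega> e"
      then have "escape n n m \<subseteq> escape n n m'" for n
        using hball_mono[of m m' N origin] by (auto simp: escape_def cross_def)
      with * show "\<forall>j\<in>{..<J}. \<exists>e\<in>escape (j * l) (j * l) m'. \<omega> e" by blast
    next
      fix m assume m: "J * l \<le> m"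
      have mj: "Suc j * l \<le> m" if "j < J" for j
        using that m by (intro order_trans[OF mult_le_mono1 m]) simp
      have dS': "depends_on (pairs (B m)) (\<lambda>\<omega>. \<forall>j<J. S j \<omega>)"
        using m by (intro depends_on_mono[OF dall] pairs_mono hball_mono)
      have dT': "depends_on (pairs (B m)) (T m j)" if "j < J" for j
        using mj[OF that] by (intro depends_on_mono[OF dT] sub) auto
      have dT'': "depends_on (pairs (B m)) (\<lambda>\<omega>. \<exists>j\<in>{..<J}. T m j \<omega>)"
        using dT' unfolding depends_on_def by (metis lessThan_iff)
      have "Pr (\<lambda>\<omega>. \<forall>j\<in>{..<J}. \<exists>e\<in>escape (j * l) (j * l) m. \<omega> e) \<le>
          Pr (\<lambda>\<omega>. (\<forall>j<J. S j \<omega>) \<or> (\<exists>j\<in>{..<J}. T m j \<omega>))"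
      proof (rule Pr_mono[OF finite_range_B])
        show "depends_on (pairs (B m)) (\<lambda>\<omega>. (\<forall>j<J. S j \<omega>) \<or> (\<exists>j\<in>{..<J}. T m j \<omega>))"
          using depends_on_comp2[OF dS' dT'', of "(\<or>)"] by simp
        have "escape n n m \<subseteq> escape n n n' \<union> escape n n' m" for n n'
          by (auto simp: escape_def cross_def)
        then show "(\<forall>j<J. S j \<omega>) \<or> (\<exists>j\<in>{..<J}. T m j \<omega>)"
          if "\<forall>j\<in>{..<J}. \<exists>e\<in>escape (j * l) (j * l) m. \<omega> e" for \<omega>
          using that unfolding S_def T_def by blast
      qed
      also have "\<dots> \<le> Pr (\<lambda>\<omega>. \<forall>j<J. S j \<omega>) + Pr (\<lambda>\<omega>. \<exists>j\<in>{..<J}. T m j \<omega>)"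
        by (rule Pr_disj[OF finite_range_B dS' dT''])
      also have "Pr (\<lambda>\<omega>. \<exists>j\<in>{..<J}. T m j \<omega>) \<le> (\<Sum>j\<in>{..<J}. Pr (T m j))"
        using dT' by (intro Pr_bex[OF finite_range_B[of m]]) auto
      also have "\<dots> \<le> (\<Sum>j\<in>{..<J}. \<alpha> / real N ^ l)"
        using mj by (intro sum_mono PT) auto
      finally show "Pr (\<lambda>\<omega>. \<forall>j\<in>{..<J}. \<exists>e\<in>escape (j * l) (j * l) m. \<omega> e) \<le> c ^ J + real J * (\<alpha> / real N ^ l)"
        using all[of J] by simp
    qed
  qed
  \<comment> \<open>The order of limits matters: first the gap \<open>l\<close> grows with
    \<open>J\<close> fixed, which removes the long edges, and then \<open>J\<close> grows.\<close>
  have "perc_prob N \<alpha> \<beta> \<le> c ^ J" for J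
  proof -
    have "(\<lambda>l. (1 / real N) ^ l) \<longlonglongrightarrow> 0"
      using N by (intro LIMSEQ_power_zero) auto
    then have "(\<lambda>l. c ^ J + real J * (\<alpha> * (1 / real N) ^ l)) \<longlonglongrightarrow> c ^ J + real J * (\<alpha> * 0)"
      by (intro tendsto_add tendsto_mult tendsto_const)
    then show ?thesis
      using bound[of J] by (intro LIMSEQ_le_const[of _ "c ^ J"]) (auto simp: power_one_over field_simps)
  qed
  moreover have "(\<lambda>J. c ^ J) \<longlonglongrightarrow> 0"
    using c by (intro LIMSEQ_power_zero) auto
  ultimately have "perc_prob N \<alpha> \<beta> \<le> 0"
    by (intro LIMSEQ_le_const) auto
  then show ?thesis
    by (simp add: perc_prob_def measure_le_0_iff)
qed

text \<open>Renormalisation: blocks of level \<open>K * n\<close> are good if they contain a cluster of size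
  \<open>(N ^ K - 1) ^ n\<close>. Losing at most one of \<open>N ^ K\<close> subblocks per step makes the failure probability
  essentially quadratic in the previous one, hence summable.\<close>

lemma percolates_large:
  fixes K :: nat
  defines "M \<equiv> N ^ K"
  assumes \<beta>1: "1 \<le> \<beta>" and M: "3 \<le> M" and growth: "2 * \<beta> ^ K \<le> (real (M - 1))\<^sup>2"
    and large: "16 * real M ^ 4 * \<beta> ^ K \<le> \<alpha>"
  shows "0 < perc_prob N \<alpha> \<beta>"
proof -
  \<comment> \<open>\<open>s n\<close> is the cluster size demanded at level \<open>K * n\<close>
    and \<open>q n\<close> bounds the probability that an edge inside a block of the next level is
    closed. In \<open>Q\<close> the factor 1/M^2 absorbs the number of pairs of subblocks, and the
    halving makes the errors summable.\<close>
  define s where "s = (\<lambda>n. (M - 1) ^ n)"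
  define Q where "Q = (\<lambda>n. 1 / (2 ^ (n + 2) * (real M)\<^sup>2))"
  define q where "q = (\<lambda>n. exp (- (\<alpha> / \<beta> ^ (K * Suc n))))"
  have M0: "0 < real M" using M by simp
  have "0 < 16 * real M ^ 4 * \<beta> ^ K" using M0 \<beta> by simp
  with large have \<alpha>0: "0 < \<alpha>" by linarith
  have s_Suc: "s (Suc n) = (M - 1) * s n" for n
    by (simp add: s_def)
  \<comment> \<open>By \<open>growth\<close>, the ratio of \<open>(s n)\<^sup>2\<close> to
    \<open>\<beta> ^ (K * n)\<close> is at least 2^n. In the lower bound on \<alpha>, \<beta>^K pays
    for the one level between blocks and subblocks, and 16 M^4 makes the linkage error at most half
    of \<open>Q (Suc n)\<close> after multiplication by M^2; finally exp (-t) \<le> 1/t is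
    enough.\<close>
  have e: "q n ^ (s n)\<^sup>2 \<le> 1 / (2 ^ (n + 4) * real M ^ 4)" for n
  proof -
    have "2 ^ n * (16 * real M ^ 4 * \<beta> ^ K) * \<beta> ^ (K * n) \<le> \<alpha> * (2 * \<beta> ^ K) ^ n"
    proof -
      have "2 ^ n * (16 * real M ^ 4 * \<beta> ^ K) * \<beta> ^ (K * n) = (16 * real M ^ 4 * \<beta> ^ K) * (2 * \<beta> ^ K) ^ n"
        by (simp add: power_mult power_mult_distrib)
      also have "\<dots> \<le> \<alpha> * (2 * \<beta> ^ K) ^ n"
        using large \<beta> by (intro mult_right_mono) auto
      finally show ?thesis .
    qed
    also have "\<dots> \<le> \<alpha> * ((real (M - 1))\<^sup>2) ^ n"
      using growth \<alpha>0 \<beta> by (intro mult_left_mono power_mono) auto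
    also have "((real (M - 1))\<^sup>2) ^ n = (real (s n))\<^sup>2"
      by (simp add: s_def power_mult[symmetric] mult.commute)
    finally have y: "2 ^ (n + 4) * real M ^ 4 \<le> \<alpha> / \<beta> ^ (K * Suc n) * (real (s n))\<^sup>2" (is "?x \<le> ?y")
      using \<beta> by (simp add: field_simps power_add)
    have x: "0 < ?x" using M0 by simp
    have "q n ^ (s n)\<^sup>2 = exp (- ?y)"
      by (simp add: q_def exp_of_nat_mult[symmetric] mult.commute)
    also have "\<dots> \<le> exp (- ?x)"
      using y by simp
    also have "\<dots> \<le> 1 / ?x"
    proof -
      have "?x \<le> exp ?x" using exp_ge_add_one_self[of ?x] by linarith
      then have "inverse (exp ?x) \<le> inverse ?x" using x by (rule le_imp_inverse_le)
      then show ?thesis by (simp only: exp_minus inverse_eq_divide)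
    qed
    finally show ?thesis .
  qed
  have Q0: "0 \<le> Q n" for n by (simp add: Q_def)
  have rec: "(real M)\<^sup>2 * ((Q n)\<^sup>2 + q n ^ (s n)\<^sup>2) \<le> Q (Suc n)" for n
  proof -
    have "(real M)\<^sup>2 * (Q n)\<^sup>2 = 1 / ((2 ^ (n + 2))\<^sup>2 * (real M)\<^sup>2)"
      using M0 by (simp add: Q_def power2_eq_square field_simps)
    also have "\<dots> \<le> 1 / (2 ^ (n + 4) * (real M)\<^sup>2)"
      using M0 by (intro divide_left_mono mult_right_mono mult_pos_pos)
        (auto simp: power_mult[symmetric] simp del: power_Suc intro!: power_increasing)
    finally have 1: "(real M)\<^sup>2 * (Q n)\<^sup>2 \<le> 1 / (2 ^ (n + 4) * (real M)\<^sup>2)" .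
    have "(real M)\<^sup>2 * q n ^ (s n)\<^sup>2 \<le> (real M)\<^sup>2 * (1 / (2 ^ (n + 4) * real M ^ 4))"
      using e by (intro mult_left_mono) auto
    also have "\<dots> = 1 / (2 ^ (n + 4) * (real M)\<^sup>2)"
      using M0 by (simp add: field_simps eval_nat_numeral)
    finally have 2: "(real M)\<^sup>2 * q n ^ (s n)\<^sup>2 \<le> 1 / (2 ^ (n + 4) * (real M)\<^sup>2)" .
    have "1 / (2 ^ (n + 4) * (real M)\<^sup>2) + 1 / (2 ^ (n + 4) * (real M)\<^sup>2) = Q (Suc n)"
      using M0 by (simp add: Q_def field_simps power_add)
    with 1 2 show ?thesis unfolding distrib_left by linarith
  qed
  have q01: "0 \<le> q n" "q n \<le> 1" for n
    using \<alpha> \<beta> by (auto simp: q_def)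
  \<comment> \<open>For \<beta> \<ge> 1 edges become rarer with distance, and two points of a ball
    are by ultrametricity no further apart than its radius.\<close>
  have closed: "1 - edge_prob \<alpha> \<beta> (pair_dist {u, v}) \<le> q n"
    if "x \<in> L" "u \<in> hball N x (K * Suc n)" "v \<in> hball N x (K * Suc n)" for x u v n
  proof -
    have uv: "u \<in> L" "v \<in> L" using that hball_subset by blast+
    have "v \<in> hball N u (K * Suc n)"
      using that hball_eq by blast
    then have "\<beta> ^ hier_dist u v \<le> \<beta> ^ (K * Suc n)"
      using \<beta>1 in_hball_iff_dist[OF uv] by (intro power_increasing) auto
    then have "\<alpha> / \<beta> ^ (K * Suc n) \<le> \<alpha> / \<beta> ^ hier_dist u v"
      using \<alpha> \<beta> by (intro divide_left_mono) auto
    then show ?thesis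
      by (simp add: edge_prob_def pair_dist_doubleton q_def)
  qed
  have blocks: "finite (subblocks N x (K * n) K)" "disjoint (subblocks N x (K * n) K)"
    "\<Union>(subblocks N x (K * n) K) = hball N x (K * Suc n)" "card (subblocks N x (K * n) K) = M"
    "hball N x (K * n) \<in> subblocks N x (K * n) K"
    "\<forall>D\<in>subblocks N x (K * n) K. \<exists>y\<in>L. D = hball N y (K * n)"
    if "x \<in> L" for x n
    using subblocks[OF that N, where n = "K * n" and j = K] by (auto simp: M_def add.commute)
  have good: "Pr (\<lambda>\<omega>. \<not> (\<exists>u\<in>hball N x (K * n). s n \<le> card (conn (hball N x (K * n)) \<omega> u))) \<le> Q n"
    if "x \<in> L" for x n
    using that
  proof (induction n arbitrary: x)
    case 0
    then have "conn {x} \<omega> x = {x}" for \<omega>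
      using conn_subset[of x "{x}" \<omega>] conn_refl[of x "{x}" \<omega>] by auto
    with 0 show ?case
      by (simp add: hball_0 s_def Q0)
  next
    case (Suc n)
    let ?D = "subblocks N x (K * n) K"
    note b = blocks[of x n, OF Suc.prems]
    have r: "Pr (\<lambda>\<omega>. \<not> (\<exists>u\<in>D. s n \<le> card (conn D \<omega> u))) \<le> Q n" if "D \<in> ?D" for D
      using b(6)[rule_format, OF that] Suc.IH by auto
    have "Pr (\<lambda>\<omega>. \<not> (\<exists>u\<in>\<Union>?D. (card ?D - 1) * s n \<le> card (conn (\<Union>?D) \<omega> u)))
        \<le> (real (card ?D))\<^sup>2 * ((Q n)\<^sup>2 + q n ^ (s n)\<^sup>2)"
    proof (rule block_step)
      show "finite D" if "D \<in> ?D" for D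
        using b(6)[rule_format, OF that] finite_hball by auto
      show "\<Union>?D \<subseteq> L"
        unfolding b(3) by (rule hball_subset)
      show "1 - edge_prob \<alpha> \<beta> (pair_dist {u, v}) \<le> q n" if "u \<in> \<Union>?D" "v \<in> \<Union>?D" for u v
        using that closed[OF Suc.prems] unfolding b(3) by blast
    qed (use b M r q01 in auto)
    also have "\<dots> \<le> Q (Suc n)"
      unfolding b(4) by (rule rec)
    finally show ?case
      unfolding b(3,4) s_Suc .
  qed
  \<comment> \<open>The partial sums of 1/4 + 1/8 + ...: each step adds at most
    \<open>Q (Suc n)\<close>, which is at most 1/2^(n+2).\<close>
  have own: "Pr (\<lambda>\<omega>. \<not> s n \<le> card (conn (B (K * n)) \<omega> origin)) \<le> 1 / 2 - 1 / 2 ^ Suc n" for n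
  proof (induction n)
    case 0
    have "conn {origin} \<omega> origin = {origin}" for \<omega>
      using conn_subset[of origin "{origin}" \<omega>] conn_refl[of origin "{origin}" \<omega>] by auto
    then show ?case
      by (simp add: hball_0[OF origin] s_def)
  next
    case (Suc n)
    let ?D = "subblocks N origin (K * n) K"
    note b = blocks[of origin n, OF origin]
    have r: "Pr (\<lambda>\<omega>. \<not> (\<exists>u\<in>D. s n \<le> card (conn D \<omega> u))) \<le> Q n" if "D \<in> ?D" for D
      using b(6)[rule_format, OF that] good by auto
    have "Pr (\<lambda>\<omega>. \<not> (card ?D - 1) * s n \<le> card (conn (\<Union>?D) \<omega> origin))
        \<le> Pr (\<lambda>\<omega>. \<not> s n \<le> card (conn (B (K * n)) \<omega> origin)) + (real (card ?D))\<^sup>2 * ((Q n)\<^sup>2 + q n ^ (s n)\<^sup>2)"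
    proof (rule cluster_step)
      show "finite D" if "D \<in> ?D" for D
        using b(6)[rule_format, OF that] finite_hball by auto
      show "\<Union>?D \<subseteq> L"
        unfolding b(3) by (rule hball_subset)
      show "1 - edge_prob \<alpha> \<beta> (pair_dist {u, v}) \<le> q n" if "u \<in> \<Union>?D" "v \<in> \<Union>?D" for u v
        using that closed[OF origin] unfolding b(3) by blast
    qed (use b M r q01 hball_refl[OF origin] in auto)
    also have "\<dots> \<le> (1 / 2 - 1 / 2 ^ Suc n) + Q (Suc n)"
      unfolding b(4) by (intro add_mono Suc.IH rec)
    also have "Q (Suc n) \<le> 1 / 2 ^ Suc (Suc n)"
    proof -
      have "1 \<le> (real M)\<^sup>2" using M by (simp add: one_le_power)
      then have "2 ^ Suc (Suc n) * 1 \<le> (2 ^ (Suc n + 2) * (real M)\<^sup>2 :: real)"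
        by (intro mult_mono power_increasing) auto
      then show ?thesis
        unfolding Q_def using M0 by (intro divide_left_mono) auto
    qed
    finally show ?case
      unfolding b(3,4) s_Suc by (simp add: field_simps)
  qed
  have "1 / 2 \<le> perc_prob N \<alpha> \<beta>"
    unfolding perc_prob_eq
  proof (rule Pr_infinite_ge)
    fix k
    obtain n where n: "k \<le> s n"
    proof
      \<comment> \<open>Cluster sizes tend to infinity because M \<ge> 3 makes the growth factor M -
        1 at least 2.\<close>
      have "k \<le> 2 ^ k" by simp
      also have "\<dots> \<le> (M - 1) ^ k" using M by (intro power_mono) auto
      finally show "k \<le> s k" by (simp add: s_def)
    qed
    have d: "depends_on (pairs (B (K * n))) (\<lambda>\<omega>. j \<le> card (conn (B (K * n)) \<omega> origin))" for j
      by (rule depends_on_comp[OF depends_on_conn])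
    have "Pr (\<lambda>\<omega>. \<not> s n \<le> card (conn (B (K * n)) \<omega> origin)) \<le> 1 / 2"
      using own[of n] by (rule order_trans) simp
    then have "1 / 2 \<le> Pr (\<lambda>\<omega>. s n \<le> card (conn (B (K * n)) \<omega> origin))"
      unfolding Pr_not[OF finite_range_B d] by simp
    also have "\<dots> \<le> Pr (\<lambda>\<omega>. k \<le> card (conn (B (K * n)) \<omega> origin))"
      using n by (intro Pr_mono[OF finite_range_B d]) simp
    finally show "\<exists>m. 1 / 2 \<le> Pr (\<lambda>\<omega>. k \<le> card (conn (B m) \<omega> origin))" ..
  qed
  then show ?thesis by simp
qed

end

text \<open>The ratio N^2 / \<beta> exceeds 1, so a power of it exceeds 8. Replacing N^K by N^K - 1
  at most halves it, which costs 4 in the square and leaves the required 2. The two additional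
  levels guarantee N^K \<ge> 4.\<close>

lemma ex_renormalisation_scale:
  assumes "2 \<le> N" "0 < \<beta>" "\<beta> < (real N)\<^sup>2"
  obtains K where "3 \<le> N ^ K" "2 * \<beta> ^ K \<le> (real (N ^ K - 1))\<^sup>2"
proof -
  have "1 < (real N)\<^sup>2 / \<beta>" using assms by simp
  from real_arch_pow[OF this] obtain k where k: "8 < ((real N)\<^sup>2 / \<beta>) ^ k" ..
  let ?K = "k + 2"
  have "((real N)\<^sup>2 / \<beta>) ^ k \<le> ((real N)\<^sup>2 / \<beta>) ^ ?K"
    using assms by (intro power_increasing) auto
  with k have "8 \<le> ((real N)\<^sup>2 / \<beta>) ^ ?K" by linarith
  then have 8: "8 * \<beta> ^ ?K \<le> (real N ^ ?K)\<^sup>2"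
    using assms by (simp add: power_divide field_simps power_mult[symmetric] mult.commute)
  have "(2::nat) ^ 2 \<le> N ^ 2" using assms by (intro power_mono) auto
  also have "\<dots> \<le> N ^ ?K" using assms by (intro power_increasing) auto
  finally have 4: "4 \<le> N ^ ?K" by simp
  have "real x \<le> 2 * real (x - 1)" if "4 \<le> x" for x
    using that by simp
  from this[OF 4] have "real N ^ ?K \<le> 2 * real (N ^ ?K - 1)"
    by (simp only: of_nat_power)
  then have "(real N ^ ?K)\<^sup>2 \<le> (2 * real (N ^ ?K - 1))\<^sup>2"
    by (intro power_mono) auto
  with 8 have "2 * \<beta> ^ ?K \<le> (real (N ^ ?K - 1))\<^sup>2"
    by (simp add: power_mult_distrib)
  with 4 show ?thesis by (intro that[of ?K]) auto
qed

theorem theorem1: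
  fixes N :: nat and \<beta> :: real
  assumes "N \<ge> 2" and "0 < \<beta>"
  shows "(\<beta> \<le> real N \<longrightarrow> critical_value N \<beta> = 0) \<and>
    (real N < \<beta> \<and> \<beta> < (real N)\<^sup>2 \<longrightarrow> 0 < critical_value N \<beta> \<and> critical_value N \<beta> < \<infinity>) \<and>
    (\<beta> \<ge> (real N)\<^sup>2 \<longrightarrow> critical_value N \<beta> = \<infinity>)"
proof (intro conjI impI)
  let ?A = "{\<alpha>. 0 \<le> \<alpha> \<and> perc_prob N \<alpha> \<beta> > 0}"
  have perc: "hier_percolation N \<alpha> \<beta>" if "0 \<le> \<alpha>" for \<alpha>
    using assms that by unfold_locales auto
  have ge: "ereal a \<le> critical_value N \<beta>" if "\<And>\<alpha>. 0 \<le> \<alpha> \<Longrightarrow> \<alpha> < a \<Longrightarrow> perc_prob N \<alpha> \<beta> = 0" for a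
    unfolding critical_value_def using that by (intro Inf_greatest) (force simp: not_less[symmetric])
  have le: "critical_value N \<beta> \<le> ereal a" if "0 \<le> a" "0 < perc_prob N a \<beta>" for a
    unfolding critical_value_def using that by (intro Inf_lower) auto
  show "critical_value N \<beta> = 0" if "\<beta> \<le> real N"
  proof (rule antisym)
    show "critical_value N \<beta> \<le> 0"
    proof (rule ereal_le_epsilon2)
      fix e :: real assume "0 < e"
      then show "critical_value N \<beta> \<le> 0 + ereal e"
        using le[of e] hier_percolation.percolates_low[OF perc] that by simp
    qed
    show "0 \<le> critical_value N \<beta>"
      using ge[of 0] by (simp add: zero_ereal_def)
  qed
  show "0 < critical_value N \<beta>" if "real N < \<beta> \<and> \<beta> < (real N)\<^sup>2"
  proof -
    \<comment> \<open>The value of \<alpha> at which the bound \<alpha> N / (\<beta> - N) on the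
      expected degree reaches 1.\<close>
    let ?a = "(\<beta> - real N) / real N"
    have "0 < ereal ?a" using that assms by simp
    also have "\<dots> \<le> critical_value N \<beta>"
    proof (rule ge)
      fix \<alpha> :: real assume "0 \<le> \<alpha>" "\<alpha> < ?a"
      then show "perc_prob N \<alpha> \<beta> = 0"
        using assms that by (intro hier_percolation.subcritical[OF perc]) (auto simp: field_simps)
    qed
    finally show ?thesis .
  qed
  show "critical_value N \<beta> < \<infinity>" if \<beta>: "real N < \<beta> \<and> \<beta> < (real N)\<^sup>2"
  proof -
    obtain K where K: "3 \<le> N ^ K" "2 * \<beta> ^ K \<le> (real (N ^ K - 1))\<^sup>2"
      using ex_renormalisation_scale[OF assms] \<beta> by blast
    define a where "a = 16 * real (N ^ K) ^ 4 * \<beta> ^ K"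
    have a: "0 \<le> a" using assms by (simp add: a_def)
    have "0 < perc_prob N a \<beta>"
      using K \<beta> assms by (intro hier_percolation.percolates_large[OF perc[OF a], of K]) (auto simp: a_def)
    from le[OF a this] show ?thesis
      by (rule order_le_less_trans) simp
  qed
  show "critical_value N \<beta> = \<infinity>" if "(real N)\<^sup>2 \<le> \<beta>"
  proof -
    have empty: "?A = {}"
      using hier_percolation.no_percolation_high[OF perc that] by auto
    show ?thesis
      unfolding critical_value_def empty by (simp add: top_ereal_def)
  qed
qed

end
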